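(* Let $k$ be a field, let $A$ be a free abelian group of finite rank, and let $G$ be a finite subgroup of $\mathrm{GL}(A)$ that is generated by reflections. Then the invariant algebra $R=k[A]^G$ is a semigroup algebra over $k$. In fact, there is an isomorphism of $k$-algebras $R\cong k[M]$ with $$M=A^G\times\bigl(\pi(A)\cap\Lambda_+\bigr),$$ where $\Lambda_+$ is the semigroup of dominant weights for some base of the root system $\Phi_{A,G}$.
   Context: Monoids are commutative; $k[M]$ denotes the semigroup (monoid) algebra of a monoid $M$ over $k$, and a $k$-algebra is called a semigroup algebra if it is isomorphic to $k[M]$ for some monoid $M$. The group $\mathrm{GL}(A)$ is the automorphism group of $A$; it acts on $A$ by $a\mapsto a^g$, and this action is extended $k$-linearly to the group algebra $k[A]$. $A^G$ is the subgroup of $G$-fixed elements of $A$. An element $g\in G$ is a reflection if, on $A\otimes_{\mathbb Z}\mathbb Q$, $\mathrm{Id}-g$ has rank $1$ and $g^2=\mathrm{Id}$; equivalently (for $g \in G$), $\ker_A(g+\mathrm{Id})$ is infinite cyclic (writing $A$ additively) and $\ker_A(g-\mathrm{Id})$ has rank $\operatorname{rank}(A)-1$. Write $A$ additively and embed it in $V=A\otimes_{\mathbb Z}\mathbb R$. Put $\rho(v)=|G|^{-1}\sum_{g\in G}v^g$ for $v\in V$ and $\pi=1-\rho$, so $V=\rho(V)\oplus\pi(V)$ with $\rho(V)=V^G$. For each reflection $g\in G$ let $\pm a_g$ be the two generators of the infinite cyclic group $\ker_A(g+\mathrm{Id})$, and set $$\Phi_{A,G}=\{\pm a_g\mid g \text{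 a reflection in } G\}.$$ It is known (Farkas) that $\Phi_{A,G}$ is a reduced crystallographic root system in $\pi(V)$ whose Weyl group is the restriction of $G$ to $\pi(V)$. Its weight lattice is $\Lambda=\{v\in\pi(V)\mid v-v^g\in\mathbb Z a_g \text{ for all reflections } g\in G\}$. A base of $\Phi=\Phi_{A,G}$ is a subset $\Delta=\{\alpha_1,\dots,\alpha_r\}\subseteq\Phi$ that is an $\mathbb R$-basis of $\pi(V)$ and satisfies $\Phi\subseteq\mathbb Z_+\Delta\cup-\mathbb Z_+\Delta$, where $\mathbb Z_+$ is the set of nonnegative integers; write $\alpha_i=\pm a_{g_i}$ with reflections $g_i\in G$. The fundamental dominant weights $\lambda_1,\dots,\lambda_r\in\pi(V)$ for $\Delta$ are determined by $\lambda_i-\lambda_i^{g_j}=\delta_{i,j}\alpha_j$; they form a $\mathbb Z$-basis of $\Lambda$. The semigroup of dominant weights for $\Delta$ is $\Lambda_+=\bigoplus_{i=1}^r\mathbb Z_+\lambda_i$. *)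

theory Defs
  imports "HOL-Library.Poly_Mapping" "HOL-Library.Product_Plus" Complex_Main
begin

section \<open>Abelian groups as integer modules\<close>

definition int_scale :: "int \<Rightarrow> 'a::ab_group_add \<Rightarrow> 'a" where
  "int_scale n a = (if n \<ge> 0 then (\<Sum>i<nat n. a) else - (\<Sum>i<nat (- n). a))"

lemma int_scale_of_nat_diff:
  "int_scale (int m - int n) a = (\<Sum>i<m. a) - (\<Sum>i<n. a)"
proof (cases "n \<le> m")
  case True
  then obtain d where "m = n + d" using le_Suc_ex by blast
  then show ?thesis by (induction d arbitrary: m) (auto simp: int_scale_def algebra_simps nat_add_distrib)
next
  case False
  then obtain d where d: "n = m + Suc d" using less_imp_Suc_add[of m n] by auto
  have "(\<Sum>i<m + e. a) = (\<Sum>i<m. a) + (\<Sum>i<e. a)" for e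
    by (induction e) (auto simp: algebra_simps)
  moreover have "nat (- (int m - int n)) = Suc d" using d by simp
  ultimately show ?thesis using d by (simp only: int_scale_def) simp
qed

global_interpretation int_module: module "int_scale :: int \<Rightarrow> 'a::ab_group_add \<Rightarrow> 'a"
proof
  have plus: "(\<Sum>i<m + n. x) = (\<Sum>i<m. x) + (\<Sum>i<n. x)" for m n :: nat and x :: 'a
    by (induction n) (auto simp: algebra_simps)
  have times: "(\<Sum>i<m * n. x) = (\<Sum>i<m. \<Sum>j<n. x)" for m n :: nat and x :: 'a
    by (induction m) (auto simp: plus algebra_simps)
  show "int_scale n (x + y) = int_scale n x + int_scale n y" for n and x y :: 'a
    by (simp add: int_scale_def sum.distrib)
  show "int_scale (m + n) x = int_scale m x + int_scale n x" for m n and x :: 'a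
  proof -
    obtain a b where m: "m = int a - int b" using int_diff_cases by blast
    obtain c d where n: "n = int c - int d" using int_diff_cases by blast
    have "m + n = int (a + c) - int (b + d)" using m n by simp
    then show ?thesis
      by (simp only: m n int_scale_of_nat_diff plus) (simp add: algebra_simps)
  qed
  show "int_scale m (int_scale n x) = int_scale (m * n) x" for m n and x :: 'a
  proof -
    obtain a b where m: "m = int a - int b" using int_diff_cases by blast
    obtain c d where n: "n = int c - int d" using int_diff_cases by blast
    have "m * n = int (a * c + b * d) - int (a * d + b * c)"
      by (simp add: m n algebra_simps)
    then show ?thesis
      by (simp only: m n int_scale_of_nat_diff plus times)
        (simp add: sum_subtractf algebra_simps)
  qed
  show "int_scale 1 x = x" for x :: 'a
    by (simp add: int_scale_def)
qed

definition free_abelian_finite_rank :: "'a::ab_group_add itself \<Rightarrow> bool" where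
  "free_abelian_finite_rank _ \<longleftrightarrow>
     (\<exists>B::'a set. finite B \<and> int_module.independent B \<and> int_module.span B = UNIV)"


section \<open>Tensor products over the integers\<close>

text \<open>The tensor product of two abelian groups: the free abelian group on the pairs, modulo the
  subgroup generated by the biadditivity relations.\<close>

inductive_set tensor_null :: "('a::ab_group_add \<times> 'b::ab_group_add \<Rightarrow>\<^sub>0 int) set" where
  left: "frag_of (a + a', x) - frag_of (a, x) - frag_of (a', x) \<in> tensor_null"
| right: "frag_of (a, x + x') - frag_of (a, x) - frag_of (a, x') \<in> tensor_null"
| zero: "0 \<in> tensor_null"
| diff: "c \<in> tensor_null \<Longrightarrow> d \<in> tensor_null \<Longrightarrow> c - d \<in> tensor_null"

lemma tensor_null_minus: "c \<in> tensor_null \<Longrightarrow> - c \<in> tensor_null"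
  using tensor_null.diff[OF tensor_null.zero, of c] by simp

lemma tensor_null_add: "c \<in> tensor_null \<Longrightarrow> d \<in> tensor_null \<Longrightarrow> c + d \<in> tensor_null"
  using tensor_null.diff[of c "- d"] tensor_null_minus[of d] by simp

quotient_type (overloaded) ('a, 'b) tensor = "'a::ab_group_add \<times> 'b::ab_group_add \<Rightarrow>\<^sub>0 int"
  / "\<lambda>c d. c - d \<in> tensor_null"
proof (intro equivpI reflpI sympI transpI)
  fix c d e :: "'a \<times> 'b \<Rightarrow>\<^sub>0 int"
  show "c - c \<in> tensor_null" by (simp add: tensor_null.zero)
  show "d - c \<in> tensor_null" if "c - d \<in> tensor_null"
    using tensor_null_minus[OF that] by simp
  show "c - e \<in> tensor_null" if "c - d \<in> tensor_null" "d - e \<in> tensor_null"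
    using tensor_null_add[OF that] by simp
qed

instantiation tensor :: (ab_group_add, ab_group_add) ab_group_add
begin

lift_definition zero_tensor :: "('a, 'b) tensor" is 0 .

lift_definition plus_tensor :: "('a, 'b) tensor \<Rightarrow> ('a, 'b) tensor \<Rightarrow> ('a, 'b) tensor" is "(+)"
  by (metis add_diff_add tensor_null_add)

lift_definition uminus_tensor :: "('a, 'b) tensor \<Rightarrow> ('a, 'b) tensor" is uminus
  by (metis minus_diff_minus tensor_null_minus)

lift_definition minus_tensor :: "('a, 'b) tensor \<Rightarrow> ('a, 'b) tensor \<Rightarrow> ('a, 'b) tensor" is "(-)"
  by (smt (verit) add_diff_add diff_add_eq_diff_diff_swap diff_diff_eq2 diff_add_eq
      add.commute tensor_null.diff)

instance
  by standard (transfer, simp add: tensor_null.zero algebra_simps)+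

end

lift_definition pure_tensor :: "'a::ab_group_add \<Rightarrow> 'b::ab_group_add \<Rightarrow> ('a, 'b) tensor"
  is "\<lambda>a x. frag_of (a, x)" .

lemma pure_tensor_add_left: "pure_tensor (a + b) x = pure_tensor a x + pure_tensor b x"
  by transfer (metis diff_diff_eq tensor_null.left)

lemma pure_tensor_add_right: "pure_tensor a (x + y) = pure_tensor a x + pure_tensor a y"
  by transfer (metis diff_diff_eq tensor_null.right)

lemma tensor_null_frag_extend:
  assumes "c \<in> tensor_null" and "additive f" and "additive g"
  shows "frag_extend (\<lambda>(a, x). frag_of (f a, g x)) c \<in> tensor_null"
  using assms(1)
  by induction
    (auto simp: frag_extend_diff additive.add[OF assms(2)] additive.add[OF assms(3)]
      intro: tensor_null.intros)

text \<open>\<open>tensor_map f\<close> is \<open>f \<otimes> id\<close>; it is meaningful for additive \<open>f\<close> only.\<close>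

definition tensor_map ::
    "('a::ab_group_add \<Rightarrow> 'c::ab_group_add) \<Rightarrow> ('a, 'b::ab_group_add) tensor \<Rightarrow> ('c, 'b) tensor" where
  "tensor_map f v = abs_tensor (frag_extend (\<lambda>(a, x). frag_of (f a, x)) (rep_tensor v))"

lemma tensor_map_abs:
  assumes "additive f"
  shows "tensor_map f (abs_tensor c) = abs_tensor (frag_extend (\<lambda>(a, x). frag_of (f a, x)) c)"
proof -
  have "rep_tensor (abs_tensor c) - c \<in> tensor_null"
    using Quotient3_tensor by (rule rep_abs_rsp_left) (simp add: tensor_null.zero)
  then show ?thesis
    using tensor_null_frag_extend[of _ f id] assms
    by (auto simp: tensor_map_def tensor.abs_eq_iff frag_extend_diff[symmetric] additive_def)
qed

lemma tensor_map_pure: "additive f \<Longrightarrow> tensor_map f (pure_tensor a x) = pure_tensor (f a) x"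
  by (simp add: pure_tensor.abs_eq tensor_map_abs)

lemma additive_tensor_map:
  fixes f :: "'a::ab_group_add \<Rightarrow> 'c::ab_group_add"
  assumes "additive f"
  shows "additive (tensor_map f :: ('a, 'b::ab_group_add) tensor \<Rightarrow> _)"
proof
  show "tensor_map f (v + w) = tensor_map f v + tensor_map f w" for v w :: "('a, 'b) tensor"
    by (induction v; induction w)
      (simp add: plus_tensor.abs_eq tensor_map_abs[OF assms] frag_extend_add)
qed

text \<open>Extension of scalars.\<close>

lift_definition tensor_scale :: "'b::field \<Rightarrow> ('a::ab_group_add, 'b) tensor \<Rightarrow> ('a, 'b) tensor"
  is "\<lambda>r. frag_extend (\<lambda>(a, x). frag_of (a, r * x))"
proof -
  fix r :: 'b and c d :: "'a \<times> 'b \<Rightarrow>\<^sub>0 int"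
  assume "c - d \<in> tensor_null"
  then show "frag_extend (\<lambda>(a, x). frag_of (a, r * x)) c -
      frag_extend (\<lambda>(a, x). frag_of (a, r * x)) d \<in> tensor_null"
    using tensor_null_frag_extend[of "c - d" "\<lambda>a. a" "(*) r"]
    by (simp add: frag_extend_diff additive_def distrib_left)
qed

lemma tensor_scale_pure: "tensor_scale r (pure_tensor a x) = pure_tensor a (r * x)"
  by transfer (simp add: tensor_null.zero)

lemma tensor_induct [case_names pure diff]:
  assumes pure: "\<And>a x. P (pure_tensor a x)"
    and diff: "\<And>v w. P v \<Longrightarrow> P w \<Longrightarrow> P (v - w)"
  shows "P v"
proof (induction v)
  case (1 c)
  have "P (abs_tensor 0)"
    using diff[OF pure pure, of undefined undefined undefined undefined]
    by (simp add: zero_tensor.abs_eq)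
  moreover have "P (abs_tensor (frag_of p))" for p :: "'a \<times> 'b"
    using pure[of "fst p" "snd p"] by (simp add: pure_tensor.abs_eq)
  moreover have "P (abs_tensor (b - c))" if "P (abs_tensor b)" "P (abs_tensor c)"
    for b c :: "'a \<times> 'b \<Rightarrow>\<^sub>0 int"
    using diff[OF that] by (simp add: minus_tensor.abs_eq)
  ultimately show ?case
    using frag_induction[where S = UNIV and P = "\<lambda>c. P (abs_tensor c)", OF subset_UNIV]
    by blast
qed

global_interpretation tensor: vector_space
  "tensor_scale :: 'b::field \<Rightarrow> ('a::ab_group_add, 'b) tensor \<Rightarrow> ('a, 'b) tensor"
proof
  fix r s :: 'b and v w :: "('a, 'b) tensor"
  show "tensor_scale r (v + w) = tensor_scale r v + tensor_scale r w"
    by transfer (simp add: frag_extend_add tensor_null.zero)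
  have diff: "tensor_scale r (v - w) = tensor_scale r v - tensor_scale r w" for r and v w :: "('a, 'b) tensor"
    by transfer (simp add: frag_extend_diff tensor_null.zero)
  show "tensor_scale (r + s) v = tensor_scale r v + tensor_scale s v"
    by (induction v rule: tensor_induct)
      (simp_all add: tensor_scale_pure distrib_right pure_tensor_add_right diff)
  show "tensor_scale r (tensor_scale s v) = tensor_scale (r * s) v"
    by (induction v rule: tensor_induct) (simp_all add: tensor_scale_pure mult.assoc diff)
  show "tensor_scale 1 v = v"
    by (induction v rule: tensor_induct) (simp_all add: tensor_scale_pure diff)
qed


section \<open>Automorphism groups and reflections\<close>

definition GL :: "('a::ab_group_add \<Rightarrow> 'a) set" where
  "GL = {g. bij g \<and> additive g}"

definition subgroup_GL :: "('a::ab_group_add \<Rightarrow> 'a) set \<Rightarrow> bool" where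
  "subgroup_GL G \<longleftrightarrow> G \<subseteq> GL \<and> id \<in> G \<and> (\<forall>g\<in>G. \<forall>h\<in>G. g \<circ> h \<in> G) \<and> (\<forall>g\<in>G. inv g \<in> G)"

definition reflection :: "('a::ab_group_add \<Rightarrow> 'a) \<Rightarrow> bool" where
  "reflection g \<longleftrightarrow>
     tensor.dim (range (\<lambda>v::('a, rat) tensor. v - tensor_map g v)) = 1 \<and>
     (\<forall>v::('a, rat) tensor. tensor_map g (tensor_map g v) = v)"

definition generated_by_reflections :: "('a::ab_group_add \<Rightarrow> 'a) set \<Rightarrow> bool" where
  "generated_by_reflections G \<longleftrightarrow> subgroup_GL hull {g \<in> G. reflection g} = G"

definition fixed_points :: "('a \<Rightarrow> 'a) set \<Rightarrow> 'a set" where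
  "fixed_points G = {a. \<forall>g\<in>G. g a = a}"


section \<open>Monoid algebras\<close>

text \<open>For a type \<open>'m\<close> of class \<open>comm_monoid_add\<close>, the type \<open>'m \<Rightarrow>\<^sub>0 'k\<close> with convolution is the
  monoid algebra of \<open>'m\<close>; the monoid algebra of a submonoid \<open>M\<close> is the subalgebra of elements
  supported on \<open>M\<close>. Every commutative monoid is a submonoid of such a type.\<close>

definition submonoid :: "'m::comm_monoid_add set \<Rightarrow> bool" where
  "submonoid M \<longleftrightarrow> 0 \<in> M \<and> (\<forall>a\<in>M. \<forall>b\<in>M. a + b \<in> M)"

definition monoid_algebra :: "'m::comm_monoid_add set \<Rightarrow> ('m \<Rightarrow>\<^sub>0 'k::field) set" where
  "monoid_algebra M = {f. Poly_Mapping.keys f \<subseteq> M}"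

abbreviation algebra_scale :: "'k::field \<Rightarrow> ('m \<Rightarrow>\<^sub>0 'k) \<Rightarrow> ('m \<Rightarrow>\<^sub>0 'k)" where
  "algebra_scale c \<equiv> Poly_Mapping.map ((*) c)"

definition subalgebra :: "('m::comm_monoid_add \<Rightarrow>\<^sub>0 'k::field) set \<Rightarrow> bool" where
  "subalgebra S \<longleftrightarrow> 1 \<in> S \<and> (\<forall>x\<in>S. \<forall>y\<in>S. x + y \<in> S \<and> x * y \<in> S) \<and>
     (\<forall>c. \<forall>x\<in>S. algebra_scale c x \<in> S)"

definition algebra_isomorphic ::
    "('m::comm_monoid_add \<Rightarrow>\<^sub>0 'k::field) set \<Rightarrow> ('n::comm_monoid_add \<Rightarrow>\<^sub>0 'k) set \<Rightarrow> bool" where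
  "algebra_isomorphic S T \<longleftrightarrow> subalgebra S \<and> subalgebra T \<and>
     (\<exists>\<phi>. bij_betw \<phi> S T \<and> \<phi> 1 = 1 \<and>
        (\<forall>x\<in>S. \<forall>y\<in>S. \<phi> (x + y) = \<phi> x + \<phi> y \<and> \<phi> (x * y) = \<phi> x * \<phi> y) \<and>
        (\<forall>c. \<forall>x\<in>S. \<phi> (algebra_scale c x) = algebra_scale c (\<phi> x)))"

text \<open>The type argument names the type in which the monoid is sought, since a formula cannot
  quantify over types.\<close>

definition is_semigroup_algebra ::
    "'n::comm_monoid_add itself \<Rightarrow> ('m::comm_monoid_add \<Rightarrow>\<^sub>0 'k::field) set \<Rightarrow> bool" where
  "is_semigroup_algebra _ S \<longleftrightarrow>
     (\<exists>M::'n set. submonoid M \<and> algebra_isomorphic S (monoid_algebra M))"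

definition linear_action :: "('a \<Rightarrow> 'a) \<Rightarrow> ('a \<Rightarrow>\<^sub>0 'k::field) \<Rightarrow> ('a \<Rightarrow>\<^sub>0 'k)" where
  "linear_action g f =
     (\<Sum>a\<in>Poly_Mapping.keys f. Poly_Mapping.single (g a) (Poly_Mapping.lookup f a))"

definition invariant_algebra :: "('a \<Rightarrow> 'a) set \<Rightarrow> ('a \<Rightarrow>\<^sub>0 'k::field) set" where
  "invariant_algebra G = {f. \<forall>g\<in>G. linear_action g f = f}"


section \<open>Roots and dominant weights\<close>

text \<open>The ambient space \<open>V\<close> is the real extension of scalars of the group, which maps to it
  via \<open>real_embed\<close>.\<close>

type_synonym 'a real_ext = "('a, real) tensor"

definition real_embed :: "'a::ab_group_add \<Rightarrow> 'a real_ext" where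
  "real_embed a = pure_tensor a 1"

definition average :: "('a::ab_group_add \<Rightarrow> 'a) set \<Rightarrow> 'a real_ext \<Rightarrow> 'a real_ext" where
  "average G v = tensor_scale (1 / real (card G)) (\<Sum>g\<in>G. tensor_map g v)"

definition pi_proj :: "('a::ab_group_add \<Rightarrow> 'a) set \<Rightarrow> 'a real_ext \<Rightarrow> 'a real_ext" where
  "pi_proj G v = v - average G v"

text \<open>\<open>generates_anti_fixed g a\<close>: \<open>a\<close> is one of the generators \<open>\<plusminus>a\<^sub>g\<close> of \<open>ker (g + Id)\<close>.\<close>

definition generates_anti_fixed :: "('a::ab_group_add \<Rightarrow> 'a) \<Rightarrow> 'a \<Rightarrow> bool" where
  "generates_anti_fixed g a \<longleftrightarrow> {x. g x + x = 0} = range (\<lambda>n. int_scale n a)"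

definition root_system :: "('a::ab_group_add \<Rightarrow> 'a) set \<Rightarrow> 'a real_ext set" where
  "root_system G = {real_embed a | a g. g \<in> G \<and> reflection g \<and> generates_anti_fixed g a}"

definition nonneg_combinations :: "'i set \<Rightarrow> ('i \<Rightarrow> 'a::ab_group_add real_ext) \<Rightarrow> 'a real_ext set" where
  "nonneg_combinations I v = {\<Sum>i\<in>I. tensor_scale (real (c i)) (v i) | c :: 'i \<Rightarrow> nat. True}"

definition root_base :: "('a::ab_group_add \<Rightarrow> 'a) set \<Rightarrow> 'a real_ext set \<Rightarrow> bool" where
  "root_base G \<Delta> \<longleftrightarrow> \<Delta> \<subseteq> root_system G \<and>
     tensor.independent \<Delta> \<and> tensor.span \<Delta> = range (pi_proj G) \<and>
     root_system G \<subseteq> nonneg_combinations \<Delta> (\<lambda>\<alpha>. \<alpha>) \<union> uminus ` nonneg_combinations \<Delta> (\<lambda>\<alpha>. \<alpha>)"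

text \<open>A base is indexed by its own elements, so \<open>\<omega> \<alpha>\<^sub>i\<close> is the fundamental dominant weight
  usually written \<open>\<lambda>\<^sub>i\<close>; \<open>real_embed b\<close> is the simple root \<open>\<alpha>\<^sub>j = \<plusminus>a\<^sub>g\<close> with \<open>g = g\<^sub>j\<close>.\<close>

definition fundamental_weights ::
    "('a::ab_group_add \<Rightarrow> 'a) set \<Rightarrow> 'a real_ext set \<Rightarrow> ('a real_ext \<Rightarrow> 'a real_ext) \<Rightarrow> bool" where
  "fundamental_weights G \<Delta> \<omega> \<longleftrightarrow>
     (\<forall>\<alpha>\<in>\<Delta>. \<omega> \<alpha> \<in> range (pi_proj G) \<and>
        (\<forall>g b. g \<in> G \<and> reflection g \<and> generates_anti_fixed g b \<and> real_embed b \<in> \<Delta> \<longrightarrow>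
           \<omega> \<alpha> - tensor_map g (\<omega> \<alpha>) = (if real_embed b = \<alpha> then real_embed b else 0)))"

definition dominant_weights ::
    "'a::ab_group_add real_ext set \<Rightarrow> ('a real_ext \<Rightarrow> 'a real_ext) \<Rightarrow> 'a real_ext set" where
  "dominant_weights \<Delta> \<omega> = nonneg_combinations \<Delta> \<omega>"

end

(* G preserves a positive definite integral form B on A, so the combinatorics of the root system
   (simple roots, exchange condition, dominance order) can be carried out inside the lattice A itself:
   every G-orbit contains a dominant element x, and the whole orbit lies in x minus the cone spanned
   by the simple roots.

   The fundamental weights lie in A only after multiplication by some N > 0; call these multiples l_i.
   Every a in A satisfies N a = z(a) + sum_i c_i(a) l_i with z(a) fixed by G and c_i(a) the value of
   the i-th simple coroot.  For dominant a the invariant x^z(a) * prod_i orb(l_i)^c_i(a) has leading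
   exponent N a, and all its exponents lie in N A, so it descends along multiplication by N to an
   invariant e(a).  The e(a) are multiplicative in a and unitriangular with respect to orbit sums,
   because B(d,d) strictly decreases when a dominant element is replaced by a smaller one; hence they
   form a basis of the invariants.  Finally the dominant elements of A are identified with
   A^G x M', where M' consists of the dominant weights in pi(A), by a retraction A -> A^G together with pi. *)

theory Submission
  imports Defs
begin

section \<open>Integral forms\<close>

text \<open>Scaling by N settles both. A product of orbit sums of the l_i is multiplicative by
  construction, and its exponents stay in N A because N divides every simple coroot value of each
  l_i: then l_i - g l_i is N times a nonnegative combination of simple roots. This is why the word
  argument below carries a divisibility hypothesis and the cones carry a factor N. The obstacle at
  the end is that pi(A) is in general not contained in A, and A need not be the sum of A^G and its
  intersection with pi(V). Still, A^G is the common kernel of integer-valued functionals, hence a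
  direct summand, and any retraction r onto it makes x |-> (r x, pi x) injective. The real vector
  space enters only for this last comparison with the stated base and weights.\<close>

lemma additive_int_scale:
  assumes "additive f"
  shows "f (int_scale n a) = int_scale n (f a)"
  by (simp add: int_scale_def additive.sum[OF assms] additive.minus[OF assms])

lemma int_scale_int [simp]: "int_scale n (m::int) = n * m"
  by (simp add: int_scale_def)

text \<open>Stands in for the Euclidean structure on the ambient real space. Definiteness also rules
  out torsion (\<open>scale_eq_0\<close>) and makes \<open>nat (B x x)\<close> available as a
  measure for minimality arguments.\<close>

locale int_form =
  fixes B :: "'a::ab_group_add \<Rightarrow> 'a \<Rightarrow> int"
  assumes add_left: "B (x + y) z = B x z + B y z"
    and sym: "B x y = B y x"
    and pos: "x \<noteq> 0 \<Longrightarrow> B x x > 0"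
begin

lemma additive_left: "additive (\<lambda>x. B x y)"
  by (simp add: additive_def add_left)

lemma additive_right: "additive (B x)"
  by (simp add: additive_def add_left sym[of x])

lemma scale_left [simp]: "B (int_scale n x) y = n * B x y"
  using additive_int_scale[OF additive_left] by simp

lemma scale_right [simp]: "B x (int_scale n y) = n * B x y"
  using additive_int_scale[OF additive_right] by simp

lemmas add_right = additive.add[OF additive_right]
lemmas diff_left = additive.diff[OF additive_left]
lemmas diff_right = additive.diff[OF additive_right]
lemmas minus_left [simp] = additive.minus[OF additive_left]
lemmas minus_right [simp] = additive.minus[OF additive_right]
lemmas zero_left [simp] = additive.zero[OF additive_left]
lemmas zero_right [simp] = additive.zero[OF additive_right]
lemmas sum_left = additive.sum[OF additive_left]
lemmas sum_right = additive.sum[OF additive_right]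

lemma nonneg: "B x x \<ge> 0"
  using pos[of x] by (cases "x = 0") auto

lemma eq_0_iff [simp]: "B x x = 0 \<longleftrightarrow> x = 0"
  using pos[of x] by (cases "x = 0") auto

lemma scale_eq_0 [simp]: "int_scale n (x::'a) = 0 \<longleftrightarrow> n = 0 \<or> x = 0"
proof
  assume "int_scale n x = 0"
  then have "n * B x x = 0" by (metis scale_left zero_left)
  then show "n = 0 \<or> x = 0" by simp
qed auto

lemma scale_cancel_left: "int_scale n (x::'a) = int_scale n y \<longleftrightarrow> n = 0 \<or> x = y"
  using scale_eq_0[of n "x - y"] by (simp add: int_module.scale_right_diff_distrib)

lemma scale_cancel_right: "int_scale m (x::'a) = int_scale n x \<longleftrightarrow> m = n \<or> x = 0"
  using scale_eq_0[of "m - n" x] by (simp add: int_module.scale_left_diff_distrib)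

text \<open>A shortest nonzero element \<open>a\<close> of \<open>K\<close> generates it. Given m x
  = n a, dividing n by m with remainder produces y in \<open>K\<close> with m y = (n mod m) a;
  comparing lengths, y is shorter than \<open>a\<close> and therefore vanishes.\<close>

lemma rank_one_cyclic:
  fixes K :: "'a set"
  assumes diff: "\<And>x y. x \<in> K \<Longrightarrow> y \<in> K \<Longrightarrow> x - y \<in> K"
    and dep: "\<And>x y. x \<in> K \<Longrightarrow> y \<in> K \<Longrightarrow> y \<noteq> 0 \<Longrightarrow> \<exists>m n. m \<noteq> 0 \<and> int_scale m x = int_scale n y"
    and nontrivial: "\<exists>x\<in>K. x \<noteq> 0"
  obtains a where "a \<noteq> 0" and "K = range (\<lambda>n. int_scale n a)"
proof -
  obtain a where a: "a \<in> K" "a \<noteq> 0"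
    and min: "\<And>x. x \<in> K \<Longrightarrow> x \<noteq> 0 \<Longrightarrow> nat (B a a) \<le> nat (B x x)"
    using ex_has_least_nat[of "\<lambda>x. x \<in> K \<and> x \<noteq> 0" _ "\<lambda>x. nat (B x x)"] nontrivial by metis
  have "0 \<in> K" using diff[OF a(1) a(1)] by simp
  then have minus: "- x \<in> K" if "x \<in> K" for x using diff[OF _ that] by fastforce
  then have add: "x + y \<in> K" if "x \<in> K" "y \<in> K" for x y using diff[OF that(1) minus[OF that(2)]] by simp
  have "(\<Sum>i<k. a) \<in> K" for k :: nat
    by (induction k) (use \<open>0 \<in> K\<close> a add in auto)
  then have scale: "int_scale n a \<in> K" for n
    using minus by (simp add: int_scale_def)
  have "x \<in> range (\<lambda>n. int_scale n a)" if x: "x \<in> K" for x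
  proof -
    obtain m n where m: "m \<noteq> 0" and mn: "int_scale m x = int_scale n a" using dep[OF x a] by blast
    define y where "y = x - int_scale (n div m) a"
    have "y \<in> K" using diff[OF x scale] by (simp add: y_def)
    have "int_scale m y = int_scale (n mod m) a"
      by (simp add: y_def int_module.scale_right_diff_distrib mn minus_div_mult_eq_mod[symmetric]
          int_module.scale_left_diff_distrib mult.commute)
    then have "B (int_scale m y) (int_scale m y) = B (int_scale (n mod m) a) (int_scale (n mod m) a)"
      by simp
    then have eq: "m\<^sup>2 * B y y = (n mod m)\<^sup>2 * B a a"
      by (simp add: power2_eq_square mult.assoc)
    have "\<bar>n mod m\<bar> < \<bar>m\<bar>" using m by (rule abs_mod_less)
    then have "(n mod m)\<^sup>2 < m\<^sup>2" by (simp add: power2_strict_mono)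
    then have "m\<^sup>2 * B y y < m\<^sup>2 * B a a" using eq pos[OF a(2)] by simp
    then have "B y y < B a a" by (simp add: mult_less_cancel_left split: if_splits)
    then have "nat (B y y) < nat (B a a)" using pos[OF a(2)] by linarith
    then have "y = 0" using min[OF \<open>y \<in> K\<close>] by linarith
    then show ?thesis by (simp add: y_def)
  qed
  then have "K = range (\<lambda>n. int_scale n a)" using scale by auto
  with that a show thesis by blast
qed

end

lemma free_coordinates:
  assumes "free_abelian_finite_rank TYPE('a::ab_group_add)"
  obtains I :: "'a::ab_group_add set" and f :: "'a \<Rightarrow> 'a \<Rightarrow> int" where
    "finite I" "\<And>i. additive (f i)" "\<And>x. \<forall>i\<in>I. f i x = 0 \<Longrightarrow> x = 0"
proof -
  obtain I :: "'a set" where I: "finite I" "int_module.independent I" "int_module.span I = UNIV"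
    using assms by (auto simp: free_abelian_finite_rank_def)
  show thesis
  proof
    show "additive (\<lambda>x. int_module.representation I x i)" for i
      using I by (simp add: additive_def int_module.representation_add)
    fix x assume "\<forall>i\<in>I. int_module.representation I x i = 0"
    then show "x = 0"
      using int_module.sum_representation_eq[of I x I] I by simp
  qed (fact I)
qed

lemma free_form:
  assumes "free_abelian_finite_rank TYPE('a::ab_group_add)"
  obtains B :: "'a::ab_group_add \<Rightarrow> 'a \<Rightarrow> int" where "int_form B"
proof -
  obtain I :: "'a set" and f :: "'a \<Rightarrow> 'a \<Rightarrow> int" where f: "finite I" "\<And>i. additive (f i)"
    and sep: "\<And>x. \<forall>i\<in>I. f i x = 0 \<Longrightarrow> x = 0"
    using free_coordinates[OF assms] by blast
  show thesis
  proof
    show "int_form (\<lambda>x y. \<Sum>i\<in>I. f i x * f i y)"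
    proof
      fix x :: 'a assume "x \<noteq> 0"
      then obtain i where "i \<in> I" "f i x \<noteq> 0" using sep[of x] by blast
      then show "(\<Sum>i\<in>I. f i x * f i x) > 0"
        using \<open>finite I\<close> by (intro sum_pos2[of I i]) (auto simp: zero_less_mult_iff)
    qed (simp_all add: additive.add[OF f(2)] algebra_simps sum.distrib)
  qed
qed

section \<open>Functionals on tensor products\<close>

definition frag_eval :: "('p \<Rightarrow> 'b::comm_ring_1) \<Rightarrow> ('p \<Rightarrow>\<^sub>0 int) \<Rightarrow> 'b" where
  "frag_eval h c = (\<Sum>p\<in>Poly_Mapping.keys c. of_int (Poly_Mapping.lookup c p) * h p)"

lemma frag_eval_superset:
  assumes "finite S" and "Poly_Mapping.keys c \<subseteq> S"
  shows "frag_eval h c = (\<Sum>p\<in>S. of_int (Poly_Mapping.lookup c p) * h p)"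
  unfolding frag_eval_def using assms
  by (intro sum.mono_neutral_left) (auto simp: in_keys_iff)

lemma frag_eval_of [simp]: "frag_eval h (frag_of p) = h p"
  by (simp add: frag_eval_def)

lemma frag_eval_zero [simp]: "frag_eval h 0 = 0"
  by (simp add: frag_eval_def)

lemma frag_eval_diff [simp]: "frag_eval h (c - d) = frag_eval h c - frag_eval h d"
proof -
  let ?S = "Poly_Mapping.keys c \<union> Poly_Mapping.keys d"
  have "frag_eval h (c - d) = (\<Sum>p\<in>?S. of_int (Poly_Mapping.lookup (c - d) p) * h p)"
    by (intro frag_eval_superset) (auto simp: keys_diff)
  also have "\<dots> = (\<Sum>p\<in>?S. of_int (Poly_Mapping.lookup c p) * h p) -
      (\<Sum>p\<in>?S. of_int (Poly_Mapping.lookup d p) * h p)"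
    by (simp add: lookup_minus left_diff_distrib sum_subtractf)
  also have "\<dots> = frag_eval h c - frag_eval h d"
    by (simp add: frag_eval_superset[of ?S])
  finally show ?thesis .
qed

text \<open>The map f tensor id followed by the identification of Z tensor b with b. Such
  functionals certify that two tensors differ, which is hard to see from the congruence modulo
  \<open>tensor_null\<close>.\<close>

definition tensor_eval :: "('a::ab_group_add \<Rightarrow> int) \<Rightarrow> ('a, 'b::field) tensor \<Rightarrow> 'b" where
  "tensor_eval f v = frag_eval (\<lambda>(a, x). of_int (f a) * x) (rep_tensor v)"

context
  fixes f :: "'a::ab_group_add \<Rightarrow> int"
  assumes f: "additive f"
begin

lemma tensor_eval_abs:
  "tensor_eval f (abs_tensor c :: ('a, 'b::field) tensor) = frag_eval (\<lambda>(a, x). of_int (f a) * x) c"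
proof -
  have null: "frag_eval (\<lambda>(a, x). of_int (f a) * x) d = 0"
    if "d \<in> tensor_null" for d :: "'a \<times> 'b \<Rightarrow>\<^sub>0 int"
    using that by induction (simp_all add: additive.add[OF f] distrib_left distrib_right)
  have "rep_tensor (abs_tensor c) - c \<in> tensor_null"
    using Quotient3_tensor by (rule rep_abs_rsp_left) (simp add: tensor_null.zero)
  from null[OF this] show ?thesis by (simp add: tensor_eval_def)
qed

lemma tensor_eval_pure [simp]: "tensor_eval f (pure_tensor a x) = of_int (f a) * x"
  by (simp add: pure_tensor.abs_eq tensor_eval_abs)

lemma tensor_eval_diff [simp]: "tensor_eval f (v - w) = tensor_eval f v - tensor_eval f w"
  by (induction v; induction w) (simp add: minus_tensor.abs_eq tensor_eval_abs)

lemma tensor_eval_scale [simp]: "tensor_eval f (tensor_scale r v) = r * tensor_eval f v"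
  by (induction v rule: tensor_induct)
    (simp_all add: tensor_scale_pure tensor.scale_right_diff_distrib right_diff_distrib)

lemma additive_tensor_eval: "additive (tensor_eval f)"
proof
  show "tensor_eval f (v + w) = tensor_eval f v + tensor_eval f w" for v w :: "('a, 'b::field) tensor"
    using tensor_eval_diff[of v "0 - w"] tensor_eval_diff[of 0 w] tensor_eval_diff[of 0 0] by simp
qed

end

lemma pure_tensor_additive: "additive (\<lambda>a. pure_tensor a x)"
  by (simp add: additive_def pure_tensor_add_left)

lemmas pure_tensor_zero_left = additive.zero[OF pure_tensor_additive]
  and pure_tensor_minus_left = additive.minus[OF pure_tensor_additive]
  and pure_tensor_diff_left = additive.diff[OF pure_tensor_additive]

lemma pure_tensor_int_scale:
  "pure_tensor (int_scale n a) (x::'b::field) = tensor_scale (of_int n) (pure_tensor a x)"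
proof -
  have nat: "pure_tensor (\<Sum>i<m. a) x = tensor_scale (of_nat m) (pure_tensor a x)" for m :: nat
    by (induction m) (simp_all add: pure_tensor_zero_left pure_tensor_add_left tensor.scale_left_distrib)
  show ?thesis
    unfolding int_scale_def nat[symmetric]
    by (cases "n \<ge> 0")
      (simp_all only: if_True if_False nat pure_tensor_minus_left of_nat_nat, simp_all)
qed

lemma tensor_map_scale:
  assumes "additive g"
  shows "tensor_map g (tensor_scale r v) = tensor_scale r (tensor_map g v)"
  by (induction v rule: tensor_induct)
    (simp_all add: tensor_scale_pure tensor_map_pure[OF assms] tensor.scale_right_diff_distrib
      additive.diff[OF additive_tensor_map[OF assms]])

lemma tensor_map_comp:
  assumes "additive g" and "additive h"
  shows "tensor_map g (tensor_map h v) = tensor_map (\<lambda>x. g (h x)) v"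
proof -
  have gh: "additive (\<lambda>x. g (h x))" using assms by (simp add: additive_def)
  show ?thesis
    by (induction v rule: tensor_induct)
      (simp_all add: tensor_map_pure[OF assms(1)] tensor_map_pure[OF assms(2)] tensor_map_pure[OF gh]
        additive.diff[OF additive_tensor_map[OF assms(1)]] additive.diff[OF additive_tensor_map[OF assms(2)]]
        additive.diff[OF additive_tensor_map[OF gh]])
qed

text \<open>Coordinates on a free group survive scalar extension as
  \<open>tensor_eval (f i)\<close>, and characteristic zero allows an integer coordinate to be
  recovered from its image in the field.\<close>

lemma pure_tensor_eq_0_iff:
  assumes "free_abelian_finite_rank TYPE('a::ab_group_add)"
  shows "pure_tensor (a::'a) (1::'b::field_char_0) = 0 \<longleftrightarrow> a = 0"
proof
  obtain I :: "'a set" and f :: "'a \<Rightarrow> 'a \<Rightarrow> int" where f: "finite I" "\<And>i. additive (f i)"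
    and sep: "\<And>x. \<forall>i\<in>I. f i x = 0 \<Longrightarrow> x = 0"
    using free_coordinates[OF assms] by blast
  assume a: "pure_tensor a (1::'b) = 0"
  have "f i a = 0" for i
  proof -
    have "(0::'b) = tensor_eval (f i) (pure_tensor a 1)"
      by (simp only: a additive.zero[OF additive_tensor_eval[OF f(2)]])
    then show ?thesis by (simp add: tensor_eval_pure[OF f(2)])
  qed
  then show "a = 0" using sep[of a] by blast
qed (simp add: pure_tensor_zero_left)

lemma pure_tensor_eq_iff:
  assumes "free_abelian_finite_rank TYPE('a::ab_group_add)"
  shows "pure_tensor (a::'a) (1::'b::field_char_0) = pure_tensor b 1 \<longleftrightarrow> a = b"
  using pure_tensor_eq_0_iff[OF assms, of "a - b", where ?'b = 'b] by (simp add: pure_tensor_diff_left)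

section \<open>Integral description of reflections\<close>

text \<open>Id - g sends b tensor x to (c b) x times a tensor 1, so its image lies in the line
  through a tensor 1. The value \<open>c a = 2\<close> makes g an involution and, by way of
  half-multiples of a, the whole line attained.\<close>

lemma reflectionI:
  fixes a :: "'a::ab_group_add"
  assumes free: "free_abelian_finite_rank TYPE('a)" and "a \<noteq> 0" and c: "additive c" "c a = 2"
    and g: "\<And>x. g x = x - int_scale (c x) a"
  shows "reflection g"
proof -
  let ?p = "pure_tensor a (1::rat)"
  have add: "additive g"
    by (simp add: additive_def g additive.add[OF c(1)] int_module.scale_left_distrib)
  note map_diff = additive.diff[OF additive_tensor_map[OF add]]
  have involution: "g (g x) = x" for x
    by (simp add: g additive.diff[OF c(1)] additive_int_scale[OF c(1)] c(2)
        int_module.scale_left_diff_distrib)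
  have root_part: "pure_tensor b x - tensor_map g (pure_tensor b x) = tensor_scale (of_int (c b) * x) ?p"
    for b and x :: rat
    using pure_tensor_int_scale[of "c b" a x]
    by (simp add: tensor_map_pure[OF add] g pure_tensor_diff_left tensor_scale_pure)
  have "\<forall>v::('a, rat) tensor. tensor_map g (tensor_map g v) = v"
  proof
    show "tensor_map g (tensor_map g v) = v" for v :: "('a, rat) tensor"
      by (induction v rule: tensor_induct) (simp_all add: tensor_map_pure[OF add] involution map_diff)
  qed
  moreover have "range (\<lambda>v::('a, rat) tensor. v - tensor_map g v) = tensor.span {?p}"
  proof (intro equalityI subsetI)
    fix w assume "w \<in> range (\<lambda>v::('a, rat) tensor. v - tensor_map g v)"
    then obtain v where w: "w = v - tensor_map g v" by blast
    show "w \<in> tensor.span {?p}" unfolding w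
    proof (induction v rule: tensor_induct)
      case (pure b x)
      then show ?case by (simp add: root_part
            tensor.span_scale tensor.span_base)
    next
      case (diff v w)
      then show ?case using tensor.span_diff[OF diff] by (simp add: map_diff algebra_simps)
    qed
  next
    fix w assume "w \<in> tensor.span {?p}"
    then obtain r where "w = tensor_scale r ?p" by (auto simp: tensor.span_singleton)
    then have "w = pure_tensor a (r / 2) - tensor_map g (pure_tensor a (r / 2))"
      by (simp add: root_part c(2))
    then show "w \<in> range (\<lambda>v::('a, rat) tensor. v - tensor_map g v)" by blast
  qed
  moreover have "tensor.dim (tensor.span {?p}) = 1"
    using tensor.dim_span_eq_card_independent[of "{?p}"] \<open>a \<noteq> 0\<close>
    by (simp add: pure_tensor_eq_0_iff[OF free])
  ultimately show ?thesis by (simp add: reflection_def)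
qed

lemma reflection_involution:
  assumes "free_abelian_finite_rank TYPE('a::ab_group_add)" and "additive g" and "reflection g"
  shows "g (g x) = (x::'a)"
  using assms(3) pure_tensor_eq_iff[OF assms(1), of "g (g x)" x, where ?'b = rat]
  by (metis reflection_def tensor_map_pure[OF assms(2)])

text \<open>Over the rationals the image of Id - g is a line, spanned by \<open>p\<close>. An
  anti-fixed y satisfies y tensor 1 = (Id - g)(y tensor 1/2) and so lies on it; hence anti-fixed
  elements are pairwise commensurable and \<open>rank_one_cyclic\<close> applies. Nontriviality
  comes from the elements x - g x, as g is not the identity.\<close>

lemma reflection_root:
  fixes g :: "'a::ab_group_add \<Rightarrow> 'a"
  assumes free: "free_abelian_finite_rank TYPE('a)" and add: "additive g" and refl: "reflection g"
  obtains a where "a \<noteq> 0" "generates_anti_fixed g a"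
proof -
  let ?W = "range (\<lambda>v::('a, rat) tensor. v - tensor_map g v)"
  obtain X where X: "X \<subseteq> ?W" "tensor.independent X" "?W \<subseteq> tensor.span X" "card X = tensor.dim ?W"
    using tensor.basis_exists by blast
  then obtain p where p: "X = {p}" using refl by (auto simp: reflection_def card_1_singleton_iff)
  have "p \<noteq> 0" using X(2) p by simp
  note involution = reflection_involution[OF free add refl]
  have "\<exists>x. g x \<noteq> x"
  proof (rule ccontr)
    assume "\<nexists>x. g x \<noteq> x"
    then have "tensor_map g v = v" for v :: "('a, rat) tensor"
      by (induction v rule: tensor_induct)
        (simp_all add: tensor_map_pure[OF add] additive.diff[OF additive_tensor_map[OF add]])
    then have "?W = {0}" by auto
    then show False using X(1) p \<open>p \<noteq> 0\<close> by auto
  qed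
  then obtain x where x: "g x \<noteq> x" by blast
  let ?K = "{x. g x + x = 0}"
  obtain B :: "'a \<Rightarrow> 'a \<Rightarrow> int" where "int_form B" using free_form[OF free] .
  then interpret int_form B .
  have multiple: "\<exists>r. pure_tensor y 1 = tensor_scale r p" if "y \<in> ?K" for y
  proof -
    have "g y = - y" using that by (simp add: eq_neg_iff_add_eq_0)
    then have "pure_tensor y (1/2) - tensor_map g (pure_tensor y (1/2)) = pure_tensor y (1/2) + pure_tensor y (1/2 :: rat)"
      by (simp add: tensor_map_pure[OF add] pure_tensor_minus_left)
    also have "\<dots> = pure_tensor y 1" by (simp flip: pure_tensor_add_right)
    finally have "pure_tensor y 1 \<in> tensor.span X" using X(3) by (metis rangeI subsetD)
    then show ?thesis by (auto simp: p tensor.span_singleton)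
  qed
  obtain a where "a \<noteq> 0" "?K = range (\<lambda>n. int_scale n a)"
  proof (rule rank_one_cyclic)
    show "x - y \<in> ?K" if "x \<in> ?K" "y \<in> ?K" for x y
      using that by (simp add: additive.diff[OF add] eq_neg_iff_add_eq_0[symmetric])
    show "\<exists>m n. m \<noteq> 0 \<and> int_scale m y = int_scale n z" if yz: "y \<in> ?K" "z \<in> ?K" "z \<noteq> 0" for y z
    proof -
      obtain r s where r: "pure_tensor y 1 = tensor_scale r p" and s: "pure_tensor z 1 = tensor_scale s p"
        using multiple[OF yz(1)] multiple[OF yz(2)] by blast
      have "s \<noteq> 0" using s yz(3) pure_tensor_eq_0_iff[OF free, of z, where ?'b = rat] by auto
      \<comment> \<open>Clearing the denominator of r / s turns proportionality over the rationals
        into an integer relation, which descends to the group by injectivity of scalar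
        extension.\<close>
      obtain n m where nm: "quotient_of (r / s) = (n, m)" by fastforce
      have "m > 0" using quotient_of_denom_pos[OF nm] .
      have "r / s = of_int n / of_int m" using quotient_of_div[OF nm] .
      then have "of_int m * r = of_int n * s" using \<open>s \<noteq> 0\<close> \<open>m > 0\<close> by (simp add: field_simps)
      then have "pure_tensor (int_scale m y) (1::rat) = pure_tensor (int_scale n z) 1"
        by (simp add: pure_tensor_int_scale r s)
      then show ?thesis using pure_tensor_eq_iff[OF free] \<open>m > 0\<close> by (metis less_irrefl)
    qed
    show "\<exists>x\<in>?K. x \<noteq> 0"
      using x by (intro bexI[of _ "x - g x"]) (auto simp: additive.diff[OF add] involution)
  qed blast
  then show thesis using that by (simp add: generates_anti_fixed_def)
qed

section \<open>Root systems of integral reflection groups\<close>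

text \<open>A perturbation argument: x works for \<open>F\<close> and y for \<open>f\<close>. Along
  t x + y every functional that is nonzero at x excludes a single integer t; one that vanishes at x
  must be \<open>f\<close>, which is nonzero at y.\<close>

lemma exists_nonzero_for_all:
  fixes F :: "('a::ab_group_add \<Rightarrow> int) set"
  assumes "finite F" and "\<And>f. f \<in> F \<Longrightarrow> additive f" and "\<And>f. f \<in> F \<Longrightarrow> \<exists>x. f x \<noteq> 0"
  shows "\<exists>x. \<forall>f\<in>F. f x \<noteq> 0"
  using assms
proof (induction F rule: finite_induct)
  case empty
  then show ?case by simp
next
  case (insert f F)
  then obtain x where x: "\<forall>f\<in>F. f x \<noteq> 0" by auto
  obtain y where y: "f y \<noteq> 0" using insert.prems by auto
  define T where "T = insert 0 ((\<lambda>h. - (h y div h x)) ` insert f F)"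
  have "finite T" using insert.hyps by (simp add: T_def)
  then obtain t where t: "t \<notin> T" using ex_new_if_finite infinite_UNIV_int by blast
  have "h (int_scale t x + y) \<noteq> 0" if h: "h \<in> insert f F" for h
  proof
    have lin: "h (int_scale t x + y) = t * h x + h y"
      using insert.prems(1)[OF h] by (simp add: additive.add additive_int_scale)
    assume "h (int_scale t x + y) = 0"
    then have eq: "h y = - t * h x" by (simp add: lin)
    then have "h x \<noteq> 0" using h x y by auto
    then have "h y div h x = - t" unfolding eq by (rule nonzero_mult_div_cancel_right)
    then have "t \<in> T" unfolding T_def using h by (intro insertI2) (rule image_eqI[of _ _ h], simp_all)
    then show False using t by blast
  qed
  then show ?case by (intro exI[of _ "int_scale t x + y"] ballI)
qed

lemma generates_anti_fixedD:
  assumes "generates_anti_fixed g a"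
  shows "g a = - a" and "g x + x = 0 \<Longrightarrow> x \<in> range (\<lambda>n. int_scale n a)"
proof -
  have "a \<in> {x. g x + x = 0}"
    using assms unfolding generates_anti_fixed_def by (auto intro: range_eqI[of _ _ 1])
  then show "g a = - a" by (simp add: eq_neg_iff_add_eq_0)
  show "g x + x = 0 \<Longrightarrow> x \<in> range (\<lambda>n. int_scale n a)"
    using assms unfolding generates_anti_fixed_def by blast
qed

lemma GL_additive: "subgroup_GL G \<Longrightarrow> g \<in> G \<Longrightarrow> additive g"
  by (auto simp: subgroup_GL_def GL_def)

lemma GL_inv:
  assumes "subgroup_GL G" "g \<in> G"
  shows "inv g \<in> G" "g (inv g x) = x" "inv g (g x) = x"
  using assms by (auto simp: subgroup_GL_def GL_def bij_def surj_f_inv_f)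

lemma GL_comp: "subgroup_GL G \<Longrightarrow> g \<in> G \<Longrightarrow> h \<in> G \<Longrightarrow> g \<circ> h \<in> G"
  by (auto simp: subgroup_GL_def)

lemma GL_id: "subgroup_GL G \<Longrightarrow> id \<in> G"
  by (auto simp: subgroup_GL_def)

lemma GL_sum_shift:
  assumes "subgroup_GL G" "g \<in> G"
  shows "(\<Sum>h\<in>G. F (h \<circ> g)) = (\<Sum>h\<in>G. F h)"
proof (rule sum.reindex_bij_witness[where i = "\<lambda>h. h \<circ> inv g" and j = "\<lambda>h. h \<circ> g"])
  show "h \<circ> g \<circ> inv g = h" "h \<circ> inv g \<circ> g = h" for h :: "'a \<Rightarrow> 'a"
    using GL_inv[OF assms] by auto
qed (use GL_comp[OF assms(1) _ GL_inv(1)[OF assms]] GL_comp[OF assms(1) _ assms(2)] in auto)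

text \<open>Summing over the group without dividing by its order keeps the form integral, and the
  summand of the identity keeps it definite.\<close>

lemma invariant_form:
  assumes free: "free_abelian_finite_rank TYPE('a::ab_group_add)"
    and G: "subgroup_GL G" "finite (G :: ('a \<Rightarrow> 'a) set)"
  obtains B :: "'a::ab_group_add \<Rightarrow> 'a \<Rightarrow> int" where "int_form B" "\<And>g x y. g \<in> G \<Longrightarrow> B (g x) (g y) = B x y"
proof -
  obtain B :: "'a \<Rightarrow> 'a \<Rightarrow> int" where "int_form B" using free_form[OF free] .
  then interpret int_form B .
  show thesis
  proof
    show "int_form (\<lambda>x y. \<Sum>h\<in>G. B (h x) (h y))"
    proof
      fix x :: 'a assume "x \<noteq> 0"
      then show "(\<Sum>h\<in>G. B (h x) (h x)) > 0"
        using G(2) GL_id[OF G(1)] nonneg by (intro sum_pos2[of G id]) (auto simp: pos)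
    qed (simp_all add: additive.add[OF GL_additive[OF G(1)]] add_left add_right sum.distrib sym)
    show "(\<Sum>h\<in>G. B (h (g x)) (h (g y))) = (\<Sum>h\<in>G. B (h x) (h y))" if "g \<in> G" for g x y
      using GL_sum_shift[OF G(1) that, of "\<lambda>h. B (h x) (h y)"] by simp
  qed
qed

locale integral_reflection_group = int_form B
  for B :: "'a::ab_group_add \<Rightarrow> 'a \<Rightarrow> int" +
  fixes G :: "('a \<Rightarrow> 'a) set"
  assumes free: "free_abelian_finite_rank TYPE('a)"
    and group: "subgroup_GL G" and finite_G: "finite G"
    and generated: "generated_by_reflections G"
    and invariant: "g \<in> G \<Longrightarrow> B (g x) (g y) = B x y"
begin

definition roots :: "'a set" where
  "roots = {a. \<exists>g\<in>G. reflection g \<and> generates_anti_fixed g a}"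

text \<open>The division is exact whenever \<open>a\<close> is a root.\<close>

definition coroot :: "'a \<Rightarrow> 'a \<Rightarrow> int" where
  "coroot a x = 2 * B x a div B a a"

definition refl :: "'a \<Rightarrow> 'a \<Rightarrow> 'a" where
  "refl a x = x - int_scale (coroot a x) a"

lemmas additive_G = GL_additive[OF group]

text \<open>As g is an involution, x - g x is anti-fixed and equals n a for some integer n.
  Invariance gives B(g x, a) = - B(x, a), so 2 B(x, a) = n B(a, a). This is the integrality of the
  coroot, and it shows that the root determines its reflection.\<close>

lemma root_reflection:
  assumes g: "g \<in> G" "reflection g" and a: "generates_anti_fixed g a"
  shows "a \<noteq> 0" and "B a a * coroot a x = 2 * B x a" and "g = refl a"
proof -
  note add = additive_G[OF g(1)]
  note inv = reflection_involution[OF free add g(2)]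
  obtain b where "b \<noteq> 0" "generates_anti_fixed g b" using reflection_root[OF free add g(2)] .
  then have "b \<in> range (\<lambda>n. int_scale n a)"
    using generates_anti_fixedD(1)[of g b] by (intro generates_anti_fixedD(2)[OF a]) simp
  then show "a \<noteq> 0" using \<open>b \<noteq> 0\<close> by auto
  note ga = generates_anti_fixedD(1)[OF a]
  have key: "B a a * coroot a x = 2 * B x a \<and> g x = refl a x" for x
  proof -
    have "g (x - g x) + (x - g x) = 0" by (simp add: additive.diff[OF add] inv)
    then obtain n where n: "x - g x = int_scale n a"
      using generates_anti_fixedD(2)[OF a] by blast
    have "B (g x) a = - B x a"
      using invariant[OF g(1), of "g x" a] by (simp add: inv ga)
    then have n2: "2 * B x a = n * B a a"
      using scale_left[of n a a] unfolding n[symmetric] diff_left by simp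
    then have "coroot a x = n" using \<open>a \<noteq> 0\<close> by (simp add: coroot_def)
    then show ?thesis using n n2 by (simp add: refl_def flip: n)
  qed
  then show "B a a * coroot a x = 2 * B x a" "g = refl a" by auto
qed

context
  fixes a assumes a: "a \<in> roots"
begin

lemma root_nonzero: "a \<noteq> 0"
  using a root_reflection(1) by (auto simp: roots_def)

lemma root_norm_pos: "B a a > 0"
  using root_nonzero pos by blast

lemma coroot_eq: "B a a * coroot a x = 2 * B x a"
  using a root_reflection(2) by (auto simp: roots_def)

lemma refl_in_G: "refl a \<in> G"
  using a root_reflection(3) by (auto simp: roots_def)

lemma refl_reflection: "reflection (refl a)"
  using a root_reflection(3) by (auto simp: roots_def)

lemma refl_generates: "generates_anti_fixed (refl a) a"
  using a root_reflection(3) by (auto simp: roots_def)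

lemma additive_coroot: "additive (coroot a)"
proof
  show "coroot a (x + y) = coroot a x + coroot a y" for x y
  proof -
    have "B a a * coroot a (x + y) = B a a * (coroot a x + coroot a y)"
      unfolding distrib_left by (simp only: coroot_eq add_left distrib_left)
    then show ?thesis using root_nonzero by simp
  qed
qed

lemma coroot_self [simp]: "coroot a a = 2"
  using root_nonzero by (simp add: coroot_def)

lemma coroot_pos_iff: "coroot a x > 0 \<longleftrightarrow> B x a > 0"
proof -
  have "B a a * coroot a x > 0 \<longleftrightarrow> B x a > 0" by (simp add: coroot_eq)
  then show ?thesis using root_norm_pos by (simp add: zero_less_mult_iff)
qed

lemma coroot_nonneg_iff: "coroot a x \<ge> 0 \<longleftrightarrow> B x a \<ge> 0"
proof -
  have "B a a * coroot a x \<ge> 0 \<longleftrightarrow> B x a \<ge> 0" by (simp add: coroot_eq)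
  then show ?thesis using root_norm_pos by (simp add: zero_le_mult_iff)
qed

lemma refl_self: "refl a a = - a"
  using int_module.scale_left_distrib[of 1 1 a] by (simp add: refl_def)

lemma refl_refl [simp]: "refl a (refl a x) = x"
  using reflection_involution[OF free additive_G[OF refl_in_G] refl_reflection] .

lemma refl_o_refl: "refl a \<circ> refl a = id"
  by auto

end

lemma coroot_G:
  assumes "w \<in> G" and "a \<in> roots"
  shows "coroot (w a) (w x) = coroot a x"
  using assms invariant by (simp add: coroot_def)

lemma refl_conj:
  assumes "w \<in> G" and "a \<in> roots"
  shows "refl (w a) (w x) = w (refl a x)"
  by (simp add: refl_def coroot_G assms additive.diff[OF additive_G] additive_int_scale[OF additive_G])

text \<open>The root \<open>w a\<close> belongs to the conjugate of \<open>refl a\<close> by w. The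
  anti-fixed group has to be transported as a whole, because a root is a generator of it and not
  just one of its elements.\<close>

lemma roots_closed:
  assumes w: "w \<in> G" and a: "a \<in> roots"
  shows "w a \<in> roots"
proof -
  note addw = additive_G[OF w] and addi = additive_G[OF GL_inv(1)[OF group w]]
  have conj: "refl (w a) x = w (refl a (inv w x))" for x
    using refl_conj[OF w a, of "inv w x"] GL_inv(2)[OF group w] by simp
  then have "refl (w a) = w \<circ> refl a \<circ> inv w" by (simp add: fun_eq_iff)
  then have "refl (w a) \<in> G"
    using GL_comp[OF group GL_comp[OF group w refl_in_G[OF a]] GL_inv(1)[OF group w]] by simp
  moreover have "reflection (refl (w a))"
  proof (rule reflectionI[OF free])
    show "w a \<noteq> 0" using root_nonzero[OF a] GL_inv(3)[OF group w, of a] additive.zero[OF addi] by auto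
    show "additive (\<lambda>x. coroot a (inv w x))" using additive_coroot[OF a] addi by (simp add: additive_def)
    show "coroot a (inv w (w a)) = 2" using GL_inv(3)[OF group w] a by simp
    show "refl (w a) x = x - int_scale (coroot a (inv w x)) (w a)" for x
      using coroot_G[OF w a, of "inv w x"] GL_inv(2)[OF group w] by (simp add: refl_def)
  qed
  moreover have "generates_anti_fixed (refl (w a)) (w a)"
    unfolding generates_anti_fixed_def
  proof (intro equalityI subsetI)
    fix x assume "x \<in> {x. refl (w a) x + x = 0}"
    then have "inv w (w (refl a (inv w x)) + x) = inv w 0" by (simp add: conj)
    then have "refl a (inv w x) + inv w x = 0"
      by (simp add: additive.add[OF addi] additive.zero[OF addi] GL_inv(3)[OF group w])
    then obtain n where "inv w x = int_scale n a"
      using refl_generates[OF a] by (auto simp: generates_anti_fixed_def)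
    then have "x = w (int_scale n a)" using GL_inv(2)[OF group w, of x] by simp
    then show "x \<in> range (\<lambda>n. int_scale n (w a))" by (simp add: additive_int_scale[OF addw])
  next
    fix x assume "x \<in> range (\<lambda>n. int_scale n (w a))"
    then obtain n where n: "x = int_scale n (w a)" by blast
    have "refl (w a) (w a) = - w a"
      using refl_conj[OF w a, of a] refl_self[OF a] by (simp add: additive.minus[OF addw])
    moreover have "refl (w a) x = int_scale n (refl (w a) (w a))"
      unfolding n using \<open>refl (w a) \<in> G\<close> by (intro additive_int_scale additive_G)
    ultimately show "x \<in> {x. refl (w a) x + x = 0}" by (simp add: n)
  qed
  ultimately show ?thesis by (auto simp: roots_def)
qed

lemma roots_minus: "a \<in> roots \<Longrightarrow> - a \<in> roots"
  using roots_closed[OF refl_in_G] refl_self by metis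

text \<open>The root system is reduced: proportional roots have the same reflection, so each of them
  is an integer multiple of the other.\<close>

lemma roots_multiple:
  assumes a: "a \<in> roots" and b: "b \<in> roots" and n: "b = int_scale n a"
  shows "b = a \<or> b = - a"
proof -
  have "n \<noteq> 0" using n root_nonzero[OF b] by auto
  have "refl b x = refl a x" for x
  proof -
    have "n * n * B a a * coroot b x = 2 * n * B x a" using coroot_eq[OF b, of x] by (simp add: n mult.assoc)
    also have "\<dots> = n * (B a a * coroot a x)" by (simp add: coroot_eq[OF a])
    finally have "n * coroot b x = coroot a x" using \<open>n \<noteq> 0\<close> root_nonzero[OF a] by simp
    then show ?thesis by (simp add: refl_def n mult.commute)
  qed
  then have "refl b a = - a" using refl_self[OF a] by simp
  then have "a \<in> {x. refl b x + x = 0}" by simp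
  then obtain k where "a = int_scale k b"
    using refl_generates[OF b] by (auto simp: generates_anti_fixed_def)
  then have "int_scale (k * n) a = int_scale 1 a" by (metis n int_module.scale_one int_module.scale_scale)
  then have "k * n = 1" unfolding scale_cancel_right using root_nonzero[OF a] by simp
  then have "n = 1 \<or> n = - 1" by (metis zmult_eq_1_iff)
  then show ?thesis using n by auto
qed

lemma finite_roots: "finite roots"
proof -
  have "finite {a. generates_anti_fixed g a}" if g: "g \<in> G" "reflection g" for g
  proof (cases "\<exists>a. generates_anti_fixed g a")
    case True
    then obtain a where a: "generates_anti_fixed g a" by blast
    have "b \<in> {a, - a}" if b: "generates_anti_fixed g b" for b
    proof -
      have "b \<in> range (\<lambda>n. int_scale n a)"
        using generates_anti_fixedD(1)[OF b] by (intro generates_anti_fixedD(2)[OF a]) simp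
      moreover have "a \<in> roots" "b \<in> roots" using a b g by (auto simp: roots_def)
      ultimately show ?thesis using roots_multiple by blast
    qed
    then have "{a. generates_anti_fixed g a} \<subseteq> {a, - a}" by blast
    then show ?thesis using finite_subset by blast
  qed simp
  moreover have "roots = (\<Union>g\<in>{g\<in>G. reflection g}. {a. generates_anti_fixed g a})"
    by (auto simp: roots_def)
  ultimately show ?thesis using finite_G by simp
qed

section \<open>Positive and simple roots with respect to a generic vector\<close>

definition xi :: 'a where
  "xi = (SOME x. \<forall>a\<in>roots. B x a \<noteq> 0)"

text \<open>Besides splitting the roots into positive and negative ones, the pairing with
  \<open>xi\<close> serves as the height on which the inductions over positive roots run.\<close>

lemma xi_generic: "a \<in> roots \<Longrightarrow> B xi a \<noteq> 0"
proof -
  have "\<exists>x. \<forall>f\<in>(\<lambda>a x. B x a) ` roots. f x \<noteq> 0"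
  proof (rule exists_nonzero_for_all)
    show "\<exists>x. f x \<noteq> 0" if "f \<in> (\<lambda>a x. B x a) ` roots" for f
      using that root_nonzero eq_0_iff by blast
  qed (simp add: finite_roots, erule imageE, simp only: additive_left)
  then have "\<exists>x. \<forall>a\<in>roots. B x a \<noteq> 0" by simp
  from someI_ex[OF this] show "a \<in> roots \<Longrightarrow> B xi a \<noteq> 0" by (simp add: xi_def)
qed

definition pos_roots :: "'a set" where
  "pos_roots = {a \<in> roots. B xi a > 0}"

definition simple :: "'a set" where
  "simple = {a \<in> pos_roots. \<forall>b\<in>pos_roots. \<forall>c\<in>pos_roots. a \<noteq> b + c}"

definition comb :: "('a \<Rightarrow> int) \<Rightarrow> 'a" where
  "comb n = (\<Sum>a\<in>simple. int_scale (n a) a)"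

definition root_cone :: "'a set" where
  "root_cone = {comb n | n. \<forall>a. n a \<ge> 0}"

lemma simple_pos_roots: "a \<in> simple \<Longrightarrow> a \<in> pos_roots" and pos_roots_roots: "a \<in> pos_roots \<Longrightarrow> a \<in> roots"
  unfolding simple_def pos_roots_def by blast+

lemma simple_roots: "a \<in> simple \<Longrightarrow> a \<in> roots"
  using simple_pos_roots pos_roots_roots by blast

lemma pos_roots_pos: "a \<in> pos_roots \<Longrightarrow> B xi a > 0"
  by (simp add: pos_roots_def)

lemma finite_simple: "finite simple"
  using simple_roots by (intro finite_subset[OF _ finite_roots] subsetI)

lemma roots_cases: "a \<in> roots \<Longrightarrow> a \<in> pos_roots \<or> - a \<in> pos_roots"
  using xi_generic[of a] roots_minus[of a] by (auto simp: pos_roots_def)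

lemma pos_roots_uminus: "a \<in> pos_roots \<Longrightarrow> - a \<notin> pos_roots"
  by (auto simp: pos_roots_def)

lemma comb_add: "comb m + comb n = comb (\<lambda>a. m a + n a)"
  by (simp add: comb_def int_module.scale_left_distrib sum.distrib)

lemma comb_scale: "int_scale k (comb m) = comb (\<lambda>a. k * m a)"
  by (simp add: comb_def int_module.scale_sum_right)

lemma comb_single:
  assumes "a \<in> simple"
  shows "comb (\<lambda>b. if b = a then k else 0) = int_scale k a"
proof -
  have "comb (\<lambda>b. if b = a then k else 0) = (\<Sum>b\<in>simple. if b = a then int_scale k a else 0)"
    unfolding comb_def by (intro sum.cong) auto
  then show ?thesis using finite_simple assms by simp
qed

lemma cone_I: "(\<And>a. n a \<ge> 0) \<Longrightarrow> comb n \<in> root_cone"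
  unfolding root_cone_def by blast

lemma cone_E:
  assumes "q \<in> root_cone"
  obtains n where "q = comb n" "\<And>a. n a \<ge> 0"
  using assms unfolding root_cone_def by blast

lemma cone_zero: "0 \<in> root_cone"
  using cone_I[of "\<lambda>_. 0"] by (simp add: comb_def)

lemma cone_add:
  assumes "x \<in> root_cone" "y \<in> root_cone"
  shows "x + y \<in> root_cone"
proof -
  obtain m where m: "x = comb m" "\<And>a. m a \<ge> 0" using cone_E[OF assms(1)] by metis
  obtain n where n: "y = comb n" "\<And>a. n a \<ge> 0" using cone_E[OF assms(2)] by metis
  show ?thesis unfolding m(1) n(1) comb_add by (intro cone_I add_nonneg_nonneg m n)
qed

lemma cone_scale:
  assumes "k \<ge> 0" "x \<in> root_cone"
  shows "int_scale k x \<in> root_cone"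
proof -
  obtain m where m: "x = comb m" "\<And>a. m a \<ge> 0" using cone_E[OF assms(2)] by metis
  show ?thesis unfolding m(1) comb_scale by (intro cone_I mult_nonneg_nonneg m assms)
qed

lemma simple_cone:
  assumes "a \<in> simple"
  shows "a \<in> root_cone"
  using cone_I[of "\<lambda>b. if b = a then 1 else 0"] comb_single[OF assms, of 1] by simp

text \<open>A positive root that is not simple splits into two positive roots, both of smaller
  pairing with \<open>xi\<close>.\<close>

lemma pos_roots_cone: "a \<in> pos_roots \<Longrightarrow> a \<in> root_cone"
proof (induction "nat (B xi a)" arbitrary: a rule: less_induct)
  case less
  show ?case
  proof (cases "a \<in> simple")
    case False
    then obtain b c where bc: "b \<in> pos_roots" "c \<in> pos_roots" "a = b + c" using less.prems unfolding simple_def by blast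
    then have "B xi a = B xi b + B xi c" by (simp add: add_right)
    then have "nat (B xi b) < nat (B xi a)" "nat (B xi c) < nat (B xi a)"
      using pos_roots_pos[OF bc(1)] pos_roots_pos[OF bc(2)] by auto
    then have "b \<in> root_cone" "c \<in> root_cone" using bc less.hyps by auto
    then show ?thesis using bc cone_add by simp
  qed (rule simple_cone)
qed

lemma cone_pos:
  assumes "q \<in> root_cone"
  shows "B xi q \<ge> 0" and "B xi q = 0 \<Longrightarrow> q = 0"
proof -
  obtain n where n: "q = comb n" "\<And>a. n a \<ge> 0" using cone_E[OF assms] by metis
  have eq: "B xi q = (\<Sum>a\<in>simple. n a * B xi a)" by (simp add: n comb_def sum_right)
  have nonneg: "n a * B xi a \<ge> 0" if "a \<in> simple" for a
    using n(2)[of a] pos_roots_pos[OF simple_pos_roots[OF that]] by simp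
  then show "B xi q \<ge> 0" unfolding eq by (rule sum_nonneg)
  assume "B xi q = 0"
  then have "\<forall>a\<in>simple. n a * B xi a = 0"
    unfolding eq by (subst (asm) sum_nonneg_eq_0_iff[OF finite_simple nonneg])
  then have "n a = 0" if "a \<in> simple" for a using pos_roots_pos[OF simple_pos_roots[OF that]] that by force
  then show "q = 0" by (simp add: n comb_def)
qed

lemma cone_antisym: "q \<in> root_cone \<Longrightarrow> - q \<in> root_cone \<Longrightarrow> q = 0"
  using cone_pos[of q] cone_pos[of "- q"] by auto

text \<open>The difference of two simple roots is never a root, since that would decompose one of
  them. If B(a, b) > 0, the coroot values of a on b and of b on a are positive, and neither is 1,
  because then a reflection would yield such a difference. With both at least 2, the squared lengths
  of a and b are at most B(a, b), so a - b has squared length at most 0.\<close>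

lemma simple_obtuse:
  assumes a: "a \<in> simple" and b: "b \<in> simple" and "a \<noteq> b"
  shows "B a b \<le> 0"
proof (rule ccontr)
  assume "\<not> B a b \<le> 0"
  then have B: "B a b > 0" by simp
  note aR = simple_roots[OF a] and bR = simple_roots[OF b]
  have not_root: "b' - a' \<notin> roots" if ab: "a' \<in> simple" "b' \<in> simple" for a' b'
  proof
    assume "b' - a' \<in> roots"
    then consider "b' - a' \<in> pos_roots" | "a' - b' \<in> pos_roots" using roots_cases by fastforce
    then show False
    proof cases
      case 1
      moreover have "b' = a' + (b' - a')" by simp
      ultimately show False using ab simple_pos_roots unfolding simple_def by blast
    next
      case 2
      moreover have "a' = b' + (a' - b')" by simp
      ultimately show False using ab simple_pos_roots unfolding simple_def by blast
    qed
  qed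
  have ge: "coroot a' b' \<ge> 2" if ab: "a' \<in> simple" "b' \<in> simple" "B b' a' > 0" for a' b'
  proof (rule ccontr)
    assume "\<not> coroot a' b' \<ge> 2"
    moreover have "coroot a' b' > 0" using coroot_pos_iff[OF simple_roots[OF ab(1)]] ab(3) by simp
    ultimately have "coroot a' b' = 1" by simp
    then have "refl a' b' = b' - a'" by (simp add: refl_def)
    then show False
      using not_root[OF ab(1,2)] roots_closed[OF refl_in_G[OF simple_roots[OF ab(1)]] simple_roots[OF ab(2)]] by simp
  qed
  have "B a a * 2 \<le> B a a * coroot a b"
    using ge[OF a b] B root_norm_pos[OF aR] by (intro mult_left_mono) (auto simp: sym)
  then have 1: "B a a \<le> B a b" using coroot_eq[OF aR, of b] by (simp add: sym)
  have "B b b * 2 \<le> B b b * coroot b a"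
    using ge[OF b a] B root_norm_pos[OF bR] by (intro mult_left_mono) (auto simp: sym)
  then have 2: "B b b \<le> B a b" using coroot_eq[OF bR, of a] by simp
  have "B (a - b) (a - b) = B a a - B a b - B b a + B b b" by (simp add: diff_left diff_right)
  then have "B (a - b) (a - b) \<le> 0" using 1 2 by (simp add: sym)
  then have "a - b = 0" using pos[of "a - b"] by fastforce
  then show False using \<open>a \<noteq> b\<close> by simp
qed

text \<open>The positive and the negative part of a vanishing combination agree, hence have nonpositive
  square length because distinct simple roots enclose obtuse angles.\<close>

lemma simple_independent:
  assumes n: "comb n = 0" and a: "a \<in> simple"
  shows "n a = 0"
proof -
  have le: "n a \<le> 0" if n: "comb n = 0" and a: "a \<in> simple" for n a
  proof (rule ccontr)
    assume na: "\<not> n a \<le> 0"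
    define p where "p = (\<lambda>a. max (n a) 0)"
    define m where "m = (\<lambda>a. max (- n a) 0)"
    have "comb p + int_scale (- 1) (comb m) = comb n"
      unfolding comb_scale comb_add by (intro arg_cong[of _ _ comb]) (auto simp: p_def m_def)
    then have eq: "comb p = comb m" using n by simp
    have "B (comb p) (comb m) = (\<Sum>b\<in>simple. \<Sum>c\<in>simple. p b * m c * B b c)"
      unfolding comb_def sum_left by (simp add: sum_right sum_distrib_left algebra_simps)
    also have "\<dots> \<le> 0"
    proof (intro sum_nonpos)
      fix b c assume "b \<in> simple" "c \<in> simple"
      then show "p b * m c * B b c \<le> 0"
        using simple_obtuse[of b c] by (cases "b = c") (auto simp: p_def m_def max_def mult_nonneg_nonpos)
    qed
    finally have "comb p = 0" using pos[of "comb p"] by (fastforce simp flip: eq)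
    then have "B xi (comb p) = 0" by simp
    then have "(\<Sum>b\<in>simple. p b * B xi b) = 0" by (simp add: comb_def sum_right)
    moreover have "p b * B xi b \<ge> 0" if "b \<in> simple" for b
      using pos_roots_pos[OF simple_pos_roots[OF that]] by (simp add: p_def)
    ultimately have "p a * B xi a = 0"
      using sum_nonneg_eq_0_iff[OF finite_simple, of "\<lambda>b. p b * B xi b"] a by simp
    then show False using na pos_roots_pos[OF simple_pos_roots[OF a]] by (simp add: p_def max_def split: if_splits)
  qed
  have "comb (\<lambda>a. - n a) = 0" using comb_scale[of "- 1" n] n by simp
  from le[OF n a] le[OF this a] show ?thesis by simp
qed

text \<open>If \<open>refl a b\<close> were negative, then b and - \<open>refl a b\<close> would
  both lie in the cone while their sum is a multiple of a. By independence, all coefficients of b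
  away from a vanish, so b is proportional to a and reducedness applies.\<close>

lemma refl_permutes_pos_roots:
  assumes a: "a \<in> simple" and b: "b \<in> pos_roots" and "b \<noteq> a"
  shows "refl a b \<in> pos_roots"
proof (rule ccontr)
  assume not: "refl a b \<notin> pos_roots"
  note aR = simple_roots[OF a]
  have "refl a b \<in> roots" using roots_closed[OF refl_in_G[OF aR] pos_roots_roots[OF b]] .
  then have mQ: "- refl a b \<in> root_cone" using not roots_cases pos_roots_cone by blast
  obtain m where m: "- refl a b = comb m" "\<And>c. m c \<ge> 0" using cone_E[OF mQ] by metis
  obtain n where n: "b = comb n" "\<And>c. n c \<ge> 0" using cone_E[OF pos_roots_cone[OF b]] by metis
  define e where "e = (\<lambda>c. if c = a then - coroot a b else 0)"
  have "comb n + comb m + comb e = 0"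
    unfolding e_def comb_single[OF a] by (simp flip: n m add: refl_def)
  then have sum0: "n c + m c + e c = 0" if "c \<in> simple" for c
    unfolding comb_add using simple_independent that by blast
  have "n c = 0" if "c \<in> simple" "c \<noteq> a" for c
    using sum0[OF that(1)] n(2)[of c] m(2)[of c] that by (simp add: e_def)
  then have "comb n = comb (\<lambda>c. if c = a then n a else 0)"
    by (auto simp: comb_def intro!: sum.cong)
  then have "b = int_scale (n a) a" using comb_single[OF a] n by simp
  then have "b = a \<or> b = - a" using roots_multiple[OF aR pos_roots_roots[OF b]] by blast
  then show False using \<open>b \<noteq> a\<close> pos_roots_uminus[OF simple_pos_roots[OF a]] b by auto
qed

section \<open>Words in simple reflections and the exchange condition\<close>

inductive word :: "nat \<Rightarrow> ('a \<Rightarrow> 'a) \<Rightarrow> bool" where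
  word_id: "word 0 id"
| word_step: "word k v \<Longrightarrow> a \<in> simple \<Longrightarrow> word (Suc k) (v \<circ> refl a)"

lemma word_in_G: "word k w \<Longrightarrow> w \<in> G"
  by (induction rule: word.induct) (intro GL_id[OF group] GL_comp[OF group] refl_in_G simple_roots; assumption)+

lemma word_comp: "word l w \<Longrightarrow> word k v \<Longrightarrow> word (k + l) (v \<circ> w)"
  by (induction rule: word.induct) (auto simp: o_assoc intro: word.intros)

lemma word_simple: "a \<in> simple \<Longrightarrow> word 1 (refl a)"
  using word_step[OF word_id] by simp

text \<open>Because B(b, b) > 0 and b is a nonnegative combination of simple roots, some simple a
  pairs positively with b. Then \<open>refl a b\<close> is a positive root of smaller height, and
  \<open>refl b\<close> is conjugate to its reflection by \<open>refl a\<close>.\<close>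

lemma word_reflection: "b \<in> pos_roots \<Longrightarrow> \<exists>k. word k (refl b)"
proof (induction "nat (B xi b)" arbitrary: b rule: less_induct)
  case less
  show ?case
  proof (cases "b \<in> simple")
    case False
    obtain n where n: "b = comb n" "\<And>c. n c \<ge> 0" using cone_E[OF pos_roots_cone[OF less.prems]] by metis
    have "\<exists>a\<in>simple. B b a > 0"
    proof (rule ccontr)
      assume "\<not> ?thesis"
      then have "B b (comb n) \<le> 0"
        using n(2) by (auto simp: comb_def sum_right mult_nonneg_nonpos not_less intro!: sum_nonpos)
      then show False using root_norm_pos[OF pos_roots_roots[OF less.prems]] n(1) by simp
    qed
    then obtain a where a: "a \<in> simple" "B b a > 0" by blast
    note aR = simple_roots[OF a(1)]
    have "b \<noteq> a" using False a by auto
    then have c: "refl a b \<in> pos_roots" using refl_permutes_pos_roots[OF a(1) less.prems] by simp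
    have "B xi (refl a b) = B xi b - coroot a b * B xi a" by (simp add: refl_def diff_right)
    moreover have "coroot a b * B xi a > 0"
      using coroot_pos_iff[OF aR] a(2) pos_roots_pos[OF simple_pos_roots[OF a(1)]] by simp
    ultimately have "nat (B xi (refl a b)) < nat (B xi b)" using pos_roots_pos[OF less.prems] by simp
    then obtain k where k: "word k (refl (refl a b))" using less.hyps c by blast
    have "refl b = refl a \<circ> refl (refl a b) \<circ> refl a"
      using refl_conj[OF refl_in_G[OF aR] pos_roots_roots[OF less.prems]] by (simp add: fun_eq_iff aR)
    then show ?thesis using word_step[OF word_comp[OF k word_simple[OF a(1)]] a(1)] by auto
  qed (use word_simple in blast)
qed

lemma refl_uminus:
  assumes "a \<in> roots"
  shows "refl (- a) = refl a"
proof -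
  have "coroot (- a) x = - coroot a x" for x
  proof -
    have "B a a * coroot (- a) x = B a a * - coroot a x"
      using coroot_eq[OF assms, of x] coroot_eq[OF roots_minus[OF assms], of x] by simp
    then have "B a a = 0 \<or> coroot (- a) x = - coroot a x" by (simp only: mult_cancel_left)
    then show ?thesis using root_nonzero[OF assms] by simp
  qed
  then show ?thesis by (simp add: refl_def fun_eq_iff)
qed

text \<open>The words form a subgroup that contains every reflection of \<open>G\<close>, so the
  hull in \<open>generated_by_reflections\<close> is contained in it.\<close>

lemma word_exists: "w \<in> G \<Longrightarrow> \<exists>k. word k w"
proof -
  let ?W = "{w. \<exists>k. word k w}"
  have WG: "?W \<subseteq> G" using word_in_G by blast
  have comp: "v \<circ> w \<in> ?W" if "v \<in> ?W" "w \<in> ?W" for v w using that word_comp by blast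
  have inv: "inv w \<in> ?W" if "word k w" for k w using that
  proof induction
    case word_id
    show ?case unfolding inv_id using word.word_id by blast
  next
    case (word_step k v a)
    have "bij v" "bij (refl a)"
      using word_in_G[OF word_step(1)] refl_in_G[OF simple_roots[OF word_step(2)]] group
      by (auto simp: subgroup_GL_def GL_def)
    moreover have "inv (refl a) = refl a"
      using refl_o_refl[OF simple_roots[OF word_step(2)]] by (simp add: inv_unique_comp)
    ultimately have "inv (v \<circ> refl a) = refl a \<circ> inv v" by (simp add: o_inv_distrib)
    then show ?case
      using comp[of "refl a" "inv v"] word_step.IH word_simple[OF word_step(2)] by (metis mem_Collect_eq)
  qed
  have "subgroup_GL ?W"
    unfolding subgroup_GL_def
  proof (intro conjI ballI)
    show "?W \<subseteq> GL" using WG group by (auto simp: subgroup_GL_def)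
    show "id \<in> ?W" using word_id by blast
  qed (use comp inv in blast)+
  moreover have "{g \<in> G. reflection g} \<subseteq> ?W"
  proof clarify
    fix g assume g: "g \<in> G" "reflection g"
    obtain a where a: "generates_anti_fixed g a" using reflection_root[OF free additive_G[OF g(1)] g(2)] by blast
    then have "a \<in> roots" "g = refl a" using g root_reflection(3) by (auto simp: roots_def)
    then show "\<exists>k. word k g" using roots_cases[of a] word_reflection[of a] word_reflection[of "- a"] refl_uminus[of a] by auto
  qed
  ultimately have "G \<subseteq> ?W"
    using generated unfolding generated_by_reflections_def by (metis hull_minimal)
  then show "w \<in> G \<Longrightarrow> \<exists>k. word k w" by blast
qed

text \<open>Following b through the letters from the right, at some letter a positive root turns
  negative. A simple reflection does this to its own root only, so that letter cancels and the
  others are untouched. The index is the length of a given expression, which need not be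
  reduced.\<close>

lemma word_exchange:
  "word k v \<Longrightarrow> b \<in> pos_roots \<Longrightarrow> - v b \<in> pos_roots \<Longrightarrow> \<exists>j<k. word j (v \<circ> refl b)"
proof (induction arbitrary: b rule: word.induct)
  case word_id
  then show ?case using pos_roots_uminus by simp
next
  case (word_step k v a)
  note aR = simple_roots[OF word_step.hyps(2)]
  show ?case
  proof (cases "b = a")
    case True
    then have "v \<circ> refl a \<circ> refl b = v" by (simp add: fun_eq_iff aR)
    then show ?thesis using word_step.hyps(1) by (metis lessI)
  next
    case False
    then have pos: "refl a b \<in> pos_roots" using refl_permutes_pos_roots[OF word_step.hyps(2) word_step.prems(1)] by simp
    have neg: "- v (refl a b) \<in> pos_roots" using word_step.prems(2) by simp
    obtain j where j: "j < k" "word j (v \<circ> refl (refl a b))" using word_step.IH[OF pos neg] by blast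
    have "v \<circ> refl a \<circ> refl b = v \<circ> refl (refl a b) \<circ> refl a"
      using refl_conj[OF refl_in_G[OF aR] pos_roots_roots[OF word_step.prems(1)]] by (simp add: fun_eq_iff aR)
    then show ?thesis using j(1) word.word_step[OF j(2) word_step.hyps(2)] by (metis Suc_less_eq)
  qed
qed

section \<open>Dominant elements and the dominance order on orbits\<close>

definition dominant :: "'a set" where
  "dominant = {x. \<forall>a\<in>simple. coroot a x \<ge> 0}"

lemma dominant_pairing:
  assumes "x \<in> dominant" and "q \<in> root_cone"
  shows "B x q \<ge> 0"
proof -
  obtain n where n: "q = comb n" "\<And>c. n c \<ge> 0" using cone_E[OF assms(2)] by metis
  have "B x a \<ge> 0" if "a \<in> simple" for a
    using assms(1) that unfolding dominant_def coroot_nonneg_iff[OF simple_roots[OF that], symmetric] by blast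
  then show ?thesis unfolding n comb_def sum_right using n(2) by (intro sum_nonneg) simp
qed

text \<open>Passing from v to v composed with \<open>refl a\<close> lowers the image of x by
  (\<open>coroot a x\<close>) times v a. For positive v a this adds an element of the cone to x - v
  x, and divisibility of the coroot value keeps the sum in N times the cone. For negative v a the
  word can be shortened.\<close>

lemma word_dominant:
  assumes x: "x \<in> dominant" and N: "\<And>a. a \<in> simple \<Longrightarrow> N dvd coroot a x" "N \<ge> 0"
  shows "word k w \<Longrightarrow> x - w x \<in> int_scale N ` root_cone"
proof (induction k arbitrary: w rule: less_induct)
  case (less k)
  from less.prems show ?case
  proof cases
    case word_id
    have "0 = int_scale N 0" by simp
    then show ?thesis using cone_zero by (simp add: word_id image_iff) blast
  next
    case (word_step k' v a)
    note aR = simple_roots[OF word_step(4)] and vG = word_in_G[OF word_step(3)]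
    have "v a \<in> pos_roots \<or> - v a \<in> pos_roots" using roots_closed[OF vG aR] roots_cases by blast
    then show ?thesis
    proof
      assume "- v a \<in> pos_roots"
      \<comment> \<open>The exchange is applied to the last letter \<open>a\<close> itself, so the
        shorter word represents w and not another element.\<close>
      then obtain j where "j < k'" "word j w"
        using word_exchange[OF word_step(3) simple_pos_roots[OF word_step(4)]] word_step(2) by auto
      then show ?thesis using less.IH[of j w] word_step(1) by simp
    next
      assume va: "v a \<in> pos_roots"
      obtain q where q: "q \<in> root_cone" "x - v x = int_scale N q" using less.IH[OF _ word_step(3)] word_step(1) by auto
      obtain c where c: "coroot a x = N * c" using N(1)[OF word_step(4)] by blast
      have pos: "N * c \<ge> 0" using x word_step(4) by (simp add: dominant_def flip: c)
      have "w x = v x - int_scale (coroot a x) (v a)"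
        by (simp add: word_step refl_def additive.diff[OF additive_G[OF vG]] additive_int_scale[OF additive_G[OF vG]])
      then have eq: "x - w x = int_scale N (q + int_scale c (v a))"
        using q(2) by (simp add: c int_module.scale_right_distrib diff_eq_eq add.assoc)
      show ?thesis
      proof (cases "N = 0")
        case True
        then show ?thesis using eq cone_zero by force
      next
        case False
        then have "c \<ge> 0" using pos N(2) by (simp add: zero_le_mult_iff)
        then show ?thesis using eq cone_add[OF q(1) cone_scale[OF _ pos_roots_cone[OF va]]] by blast
      qed
    qed
  qed
qed

lemma dominant_minus_orbit:
  assumes "x \<in> dominant" and "\<And>a. a \<in> simple \<Longrightarrow> N dvd coroot a x" and "N \<ge> 0" and "w \<in> G"
  shows "x - w x \<in> int_scale N ` root_cone"
  using word_dominant[OF assms(1-3)] word_exists[OF assms(4)] by blast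

text \<open>An orbit point with the largest pairing with \<open>xi\<close> is dominant: at a
  negative coroot value the simple reflection would increase that pairing.\<close>

lemma dominant_exists: "\<exists>w\<in>G. w x \<in> dominant"
proof -
  let ?f = "\<lambda>w. B xi (w x)"
  have fin: "finite (?f ` G)" and "?f ` G \<noteq> {}" using finite_G GL_id[OF group] by auto
  then have "Max (?f ` G) \<in> ?f ` G" by (rule Max_in)
  then obtain w where w: "w \<in> G" and eq: "Max (?f ` G) = ?f w" by blast
  have max: "?f v \<le> ?f w" if "v \<in> G" for v
    unfolding eq[symmetric] using fin that by (intro Max_ge imageI)
  have "coroot a (w x) \<ge> 0" if a: "a \<in> simple" for a
  proof (rule ccontr)
    assume neg: "\<not> coroot a (w x) \<ge> 0"
    have "refl a \<circ> w \<in> G" using GL_comp[OF group refl_in_G[OF simple_roots[OF a]] w] .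
    from max[OF this] have "coroot a (w x) * B xi a \<ge> 0" by (simp add: refl_def diff_right)
    then show False using neg pos_roots_pos[OF simple_pos_roots[OF a]] by (simp add: zero_le_mult_iff)
  qed
  then show ?thesis using w by (auto simp: dominant_def)
qed

lemma dominant_norm_less:
  assumes "y \<in> dominant" and "x - y \<in> root_cone" and "x \<noteq> y"
  shows "B y y < B x x"
proof -
  have "B x x = B y y + 2 * B y (x - y) + B (x - y) (x - y)"
    by (simp add: diff_left diff_right sym)
  moreover have "B (x - y) (x - y) > 0" using assms(3) by (intro pos) simp
  ultimately show ?thesis using dominant_pairing[OF assms(1,2)] by simp
qed

lemma fixed_iff: "x \<in> fixed_points G \<longleftrightarrow> (\<forall>a\<in>simple. coroot a x = 0)"
proof
  assume x: "x \<in> fixed_points G"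
  show "\<forall>a\<in>simple. coroot a x = 0"
  proof
    fix a assume a: "a \<in> simple"
    have "refl a x = x" using x refl_in_G[OF simple_roots[OF a]] by (simp add: fixed_points_def)
    then show "coroot a x = 0" using root_nonzero[OF simple_roots[OF a]] by (simp add: refl_def)
  qed
next
  assume x: "\<forall>a\<in>simple. coroot a x = 0"
  have "word k w \<Longrightarrow> w x = x" for k w
    by (induction rule: word.induct) (simp_all add: refl_def x)
  then show "x \<in> fixed_points G" using word_exists unfolding fixed_points_def by blast
qed

end

section \<open>Triangular bases of monoid algebras\<close>

text \<open>Scalars are treated as constants of the algebra from here on, so that linearity becomes
  an instance of the ring laws.\<close>

lemma algebra_scale_conv: "algebra_scale c x = Poly_Mapping.single 0 c * x"
  by (rule mult_map_scale_conv_mult)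

lemma lookup_scale: "Poly_Mapping.lookup (Poly_Mapping.single 0 c * p) x = (c::'k::field) * Poly_Mapping.lookup p x"
  by (simp add: Poly_Mapping.map.rep_eq when_def flip: mult_map_scale_conv_mult)

lemma single_sum_expansion: "f = (\<Sum>a\<in>Poly_Mapping.keys f. Poly_Mapping.single a (Poly_Mapping.lookup f a))"
proof (rule poly_mapping_eqI)
  fix x
  have "Poly_Mapping.lookup (\<Sum>a\<in>Poly_Mapping.keys f. Poly_Mapping.single a (Poly_Mapping.lookup f a)) x =
      (\<Sum>a\<in>Poly_Mapping.keys f. if a = x then Poly_Mapping.lookup f a else 0)"
    by (simp add: lookup_sum lookup_single when_def)
  then show "Poly_Mapping.lookup f x =
      Poly_Mapping.lookup (\<Sum>a\<in>Poly_Mapping.keys f. Poly_Mapping.single a (Poly_Mapping.lookup f a)) x"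
    by (simp add: in_keys_iff)
qed

definition lin_ext :: "('m \<Rightarrow> 'a::comm_monoid_add \<Rightarrow>\<^sub>0 'k::field) \<Rightarrow> ('m \<Rightarrow>\<^sub>0 'k) \<Rightarrow> 'a \<Rightarrow>\<^sub>0 'k" where
  "lin_ext e f = (\<Sum>m\<in>Poly_Mapping.keys f. Poly_Mapping.single 0 (Poly_Mapping.lookup f m) * e m)"

lemma lin_ext_superset:
  assumes "finite S" and "Poly_Mapping.keys f \<subseteq> S"
  shows "lin_ext e f = (\<Sum>m\<in>S. Poly_Mapping.single 0 (Poly_Mapping.lookup f m) * e m)"
  unfolding lin_ext_def using assms
  by (intro sum.mono_neutral_left) (auto simp: in_keys_iff)

lemma lin_ext_single [simp]: "lin_ext e (Poly_Mapping.single m c) = Poly_Mapping.single 0 c * e m"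
  using lin_ext_superset[of "{m}" "Poly_Mapping.single m c" e] by simp

lemma lin_ext_zero [simp]: "lin_ext e 0 = 0"
  by (simp add: lin_ext_def)

lemma lin_ext_add: "lin_ext e (f + h) = lin_ext e f + lin_ext e h"
proof -
  let ?S = "Poly_Mapping.keys f \<union> Poly_Mapping.keys h"
  have "lin_ext e (f + h) = (\<Sum>m\<in>?S. Poly_Mapping.single 0 (Poly_Mapping.lookup (f + h) m) * e m)"
    using keys_add[of f h] by (intro lin_ext_superset) auto
  also have "\<dots> = (\<Sum>m\<in>?S. Poly_Mapping.single 0 (Poly_Mapping.lookup f m) * e m) +
      (\<Sum>m\<in>?S. Poly_Mapping.single 0 (Poly_Mapping.lookup h m) * e m)"
    by (simp add: lookup_add single_add distrib_right sum.distrib)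
  also have "\<dots> = lin_ext e f + lin_ext e h"
    by (simp add: lin_ext_superset[of ?S])
  finally show ?thesis .
qed

lemma lin_ext_sum: "lin_ext e (sum f I) = (\<Sum>i\<in>I. lin_ext e (f i))"
  by (induction I rule: infinite_finite_induct) (simp_all add: lin_ext_add)

lemma lin_ext_mult:
  assumes e: "\<And>m n. m \<in> M \<Longrightarrow> n \<in> M \<Longrightarrow> e (m + n) = e m * e n"
    and "f \<in> monoid_algebra M" and "h \<in> monoid_algebra M"
  shows "lin_ext e (f * h) = lin_ext e f * lin_ext e h"
proof -
  let ?l = Poly_Mapping.lookup and ?s = Poly_Mapping.single
  have "f * h = (\<Sum>m\<in>Poly_Mapping.keys f. \<Sum>n\<in>Poly_Mapping.keys h. ?s (m + n) (?l f m * ?l h n))"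
    by (subst single_sum_expansion[of f], subst single_sum_expansion[of h])
      (simp add: sum_product mult_single)
  then have "lin_ext e (f * h) =
      (\<Sum>m\<in>Poly_Mapping.keys f. \<Sum>n\<in>Poly_Mapping.keys h. ?s 0 (?l f m * ?l h n) * e (m + n))"
    by (simp add: lin_ext_sum)
  also have "\<dots> = (\<Sum>m\<in>Poly_Mapping.keys f. \<Sum>n\<in>Poly_Mapping.keys h.
      (?s 0 (?l f m) * e m) * (?s 0 (?l h n) * e n))"
  proof (intro sum.cong refl)
    fix m n assume "m \<in> Poly_Mapping.keys f" "n \<in> Poly_Mapping.keys h"
    then have emn: "e (m + n) = e m * e n" using assms by (auto simp: monoid_algebra_def)
    have smn: "?s 0 (?l f m * ?l h n) = ?s 0 (?l f m) * ?s 0 (?l h n)"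
      by (simp add: mult_single)
    show "?s 0 (?l f m * ?l h n) * e (m + n) = (?s 0 (?l f m) * e m) * (?s 0 (?l h n) * e n)"
      unfolding emn smn by (simp only: mult_ac)
  qed
  finally show ?thesis unfolding lin_ext_def sum_product .
qed

lemma lin_ext_scale: "lin_ext e (Poly_Mapping.single 0 c * f) = Poly_Mapping.single 0 c * lin_ext e f"
proof -
  let ?f = "Poly_Mapping.single 0 c * f"
  have "Poly_Mapping.keys ?f \<subseteq> Poly_Mapping.keys f" by (auto simp: in_keys_iff lookup_scale)
  then have "lin_ext e ?f = (\<Sum>m\<in>Poly_Mapping.keys f. Poly_Mapping.single 0 (Poly_Mapping.lookup ?f m) * e m)"
    by (intro lin_ext_superset) auto
  also have "\<dots> = (\<Sum>m\<in>Poly_Mapping.keys f.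
      Poly_Mapping.single 0 c * (Poly_Mapping.single 0 (Poly_Mapping.lookup f m) * e m))"
    by (simp add: lookup_scale mult_single flip: mult.assoc)
  finally show ?thesis by (simp add: lin_ext_def sum_distrib_left)
qed

lemma lookup_lin_ext:
  "Poly_Mapping.lookup (lin_ext e f) x =
    (\<Sum>m\<in>Poly_Mapping.keys f. Poly_Mapping.lookup f m * Poly_Mapping.lookup (e m) x)"
  by (simp add: lin_ext_def lookup_sum lookup_scale)

lemma subalgebra_sum: "subalgebra S \<Longrightarrow> (\<And>i. i \<in> I \<Longrightarrow> f i \<in> S) \<Longrightarrow> sum f I \<in> S"
proof (induction I rule: infinite_finite_induct)
  case (insert i I)
  then show ?case by (simp add: subalgebra_def)
qed (metis subalgebra_def algebra_scale_conv mult_zero_left single_zero sum.infinite sum.empty)+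

lemma subalgebra_power: "subalgebra S \<Longrightarrow> f \<in> S \<Longrightarrow> f ^ n \<in> S"
  by (induction n) (simp_all add: subalgebra_def)

lemma subalgebra_prod: "subalgebra S \<Longrightarrow> (\<And>i. i \<in> I \<Longrightarrow> f i \<in> S) \<Longrightarrow> prod f I \<in> S"
  by (induction I rule: infinite_finite_induct) (simp_all add: subalgebra_def)

lemma subalgebra_diff:
  assumes "subalgebra S" "x \<in> S" "y \<in> S"
  shows "x - y \<in> S"
proof -
  have "algebra_scale (- 1) y = - y"
    by (simp add: algebra_scale_conv single_uminus)
  then have "- y \<in> S" using assms(1,3) unfolding subalgebra_def by metis
  then have "x + - y \<in> S" using assms(1,2) unfolding subalgebra_def by blast
  then show ?thesis by simp
qed

lemma subalgebra_monoid_algebra: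
  assumes "submonoid M"
  shows "subalgebra (monoid_algebra M :: ('m::comm_monoid_add \<Rightarrow>\<^sub>0 'k::field) set)"
  unfolding subalgebra_def
proof (intro conjI ballI allI)
  show "1 \<in> (monoid_algebra M :: ('m \<Rightarrow>\<^sub>0 'k) set)"
    using assms by (simp add: monoid_algebra_def submonoid_def)
  fix x y :: "'m \<Rightarrow>\<^sub>0 'k" assume x: "x \<in> monoid_algebra M"
  show "algebra_scale c x \<in> monoid_algebra M" for c
    using x by (auto simp: monoid_algebra_def in_keys_iff algebra_scale_conv lookup_scale)
  assume y: "y \<in> monoid_algebra M"
  show "x + y \<in> monoid_algebra M"
    using x y keys_add[of x y] by (auto simp: monoid_algebra_def)
  show "x * y \<in> monoid_algebra M"
    using x y assms keys_mult[of x y] unfolding monoid_algebra_def submonoid_def by blast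
qed

lemma algebra_isomorphic_sym:
  assumes "algebra_isomorphic S T"
  shows "algebra_isomorphic T S"
proof -
  obtain \<phi> where S: "subalgebra S" and T: "subalgebra T" and \<phi>: "bij_betw \<phi> S T" "\<phi> 1 = 1"
    "\<And>x y. x \<in> S \<Longrightarrow> y \<in> S \<Longrightarrow> \<phi> (x + y) = \<phi> x + \<phi> y"
    "\<And>x y. x \<in> S \<Longrightarrow> y \<in> S \<Longrightarrow> \<phi> (x * y) = \<phi> x * \<phi> y"
    "\<And>c x. x \<in> S \<Longrightarrow> \<phi> (algebra_scale c x) = algebra_scale c (\<phi> x)"
    using assms unfolding algebra_isomorphic_def by blast
  let ?\<psi> = "inv_into S \<phi>"
  have inv: "?\<psi> y \<in> S" "\<phi> (?\<psi> y) = y" if "y \<in> T" for y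
    using \<phi>(1) that by (auto simp: bij_betw_def inv_into_into f_inv_into_f)
  have eq: "?\<psi> y = x" if "x \<in> S" "\<phi> x = y" for x y
    using \<phi>(1) that by (auto simp: bij_betw_def)
  have "bij_betw ?\<psi> T S" using \<phi>(1) by (rule bij_betw_inv_into)
  moreover have "?\<psi> 1 = 1" using S \<phi>(2) by (intro eq) (auto simp: subalgebra_def)
  moreover have "?\<psi> (x + y) = ?\<psi> x + ?\<psi> y" "?\<psi> (x * y) = ?\<psi> x * ?\<psi> y" if "x \<in> T" "y \<in> T" for x y
    using S that inv \<phi>(3,4) by (auto intro!: eq simp: subalgebra_def)
  moreover have "?\<psi> (algebra_scale c x) = algebra_scale c (?\<psi> x)" if "x \<in> T" for c x
    using S that inv \<phi>(5) by (auto intro!: eq simp: subalgebra_def)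
  ultimately show ?thesis using S T unfolding algebra_isomorphic_def by blast
qed

text \<open>The map is \<open>lin_ext e\<close>. Elements of \<open>S\<close> are inspected only
  through their coefficients on \<open>D\<close>, which determine them; there the family
  \<open>e\<close> is unitriangular with respect to \<open>q\<close>. Injectivity is seen at an
  exponent of largest \<open>q\<close>, and surjectivity by clearing coefficients from the top
  downwards.\<close>

theorem triangular_isomorphism:
  fixes e :: "'m::comm_monoid_add \<Rightarrow> 'a::comm_monoid_add \<Rightarrow>\<^sub>0 'k::field"
    and q :: "'a \<Rightarrow> nat"
  assumes M: "submonoid M" and S: "subalgebra S"
    and e_zero: "e 0 = 1" and e_add: "\<And>m n. m \<in> M \<Longrightarrow> n \<in> M \<Longrightarrow> e (m + n) = e m * e n"
    and e_in: "\<And>m. m \<in> M \<Longrightarrow> e m \<in> S"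
    and \<tau>: "bij_betw \<tau> M D"
    and lead: "\<And>m. m \<in> M \<Longrightarrow> Poly_Mapping.lookup (e m) (\<tau> m) = 1"
    and low: "\<And>m d. m \<in> M \<Longrightarrow> d \<in> D \<Longrightarrow> Poly_Mapping.lookup (e m) d \<noteq> 0 \<Longrightarrow> d \<noteq> \<tau> m \<Longrightarrow> q d < q (\<tau> m)"
    and determined: "\<And>f. f \<in> S \<Longrightarrow> (\<And>d. d \<in> D \<Longrightarrow> Poly_Mapping.lookup f d = 0) \<Longrightarrow> f = 0"
  shows "algebra_isomorphic S (monoid_algebra M :: ('m \<Rightarrow>\<^sub>0 'k) set)"
proof (rule algebra_isomorphic_sym)
  let ?l = Poly_Mapping.lookup and ?A = "monoid_algebra M :: ('m \<Rightarrow>\<^sub>0 'k) set"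
  have in_S: "lin_ext e f \<in> S" if "f \<in> ?A" for f
    unfolding lin_ext_def
  proof (intro subalgebra_sum[OF S])
    fix m assume "m \<in> Poly_Mapping.keys f"
    then have "e m \<in> S" using that e_in by (auto simp: monoid_algebra_def)
    then show "Poly_Mapping.single 0 (?l f m) * e m \<in> S"
      using S by (simp add: subalgebra_def flip: algebra_scale_conv)
  qed
  have kernel: "f = 0" if f: "f \<in> ?A" and zero: "lin_ext e f = 0" for f
  proof (rule ccontr)
    assume "f \<noteq> 0"
    then have "(q \<circ> \<tau>) ` Poly_Mapping.keys f \<noteq> {}" by (auto simp: poly_mapping_eq_iff in_keys_iff fun_eq_iff)
    then have "Max ((q \<circ> \<tau>) ` Poly_Mapping.keys f) \<in> (q \<circ> \<tau>) ` Poly_Mapping.keys f" by (intro Max_in) auto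
    then obtain m where m: "m \<in> Poly_Mapping.keys f" and max: "Max ((q \<circ> \<tau>) ` Poly_Mapping.keys f) = q (\<tau> m)"
      by auto
    have mM: "m \<in> M" using m f by (auto simp: monoid_algebra_def)
    \<comment> \<open>By maximality of m no other basis element reaches the exponent \<tau> m, not
      even one of equal \<open>q\<close>: lower terms have strictly smaller
      \<open>q\<close>.\<close>
    have "?l (e n) (\<tau> m) = 0" if n: "n \<in> Poly_Mapping.keys f" "n \<noteq> m" for n
    proof (rule ccontr)
      assume nz: "?l (e n) (\<tau> m) \<noteq> 0"
      have nM: "n \<in> M" using n f by (auto simp: monoid_algebra_def)
      have "\<tau> m \<noteq> \<tau> n" using \<tau> n(2) nM mM by (auto simp: bij_betw_def inj_on_def)
      moreover have "\<tau> m \<in> D" using \<tau> mM by (auto simp: bij_betw_def)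
      ultimately have "q (\<tau> m) < q (\<tau> n)" using low[OF nM] nz by blast
      moreover have "q (\<tau> n) \<le> q (\<tau> m)" unfolding max[symmetric] using n by (intro Max_ge) auto
      ultimately show False by simp
    qed
    then have "?l (lin_ext e f) (\<tau> m) = (\<Sum>n\<in>Poly_Mapping.keys f. if n = m then ?l f m else 0)"
      unfolding lookup_lin_ext by (intro sum.cong) (auto simp: lead[OF mM])
    then show False using zero m by (simp add: in_keys_iff)
  qed
  \<comment> \<open>The bound b is strict, so b = 0 leaves no coefficient on \<open>D\<close> and
    \<open>determined\<close> gives f = 0.\<close>
  have surj: "f \<in> lin_ext e ` ?A"
    if "f \<in> S" and "\<And>d. d \<in> D \<Longrightarrow> ?l f d \<noteq> 0 \<Longrightarrow> q d < b" for f b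
    using that
  proof (induction b arbitrary: f)
    case 0
    then have "f = 0" by (intro determined) auto
    then have "f = lin_ext e 0" by simp
    moreover have "0 \<in> ?A" by (simp add: monoid_algebra_def)
    ultimately show ?case by blast
  next
    case (Suc b)
    let ?K = "Poly_Mapping.keys f \<inter> D"
    \<comment> \<open>All coefficients of f on \<open>D\<close> are subtracted at once, not just the
      top ones. What remains on \<open>D\<close> comes from lower terms of the basis elements used,
      so its \<open>q\<close> drops below b.\<close>
    define h where "h = (\<Sum>d\<in>?K. Poly_Mapping.single (inv_into M \<tau> d) (?l f d))"
    have \<tau>': "inv_into M \<tau> d \<in> M" "\<tau> (inv_into M \<tau> d) = d" if "d \<in> D" for d
      using \<tau> that by (auto simp: bij_betw_def inv_into_into f_inv_into_f)
    have hA: "h \<in> ?A" unfolding h_def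
      by (intro subalgebra_sum[OF subalgebra_monoid_algebra[OF M]]) (auto simp: monoid_algebra_def \<tau>')
    have lh: "?l (lin_ext e h) x = (\<Sum>d\<in>?K. ?l f d * ?l (e (inv_into M \<tau> d)) x)" for x
      by (simp add: h_def lin_ext_sum lookup_sum lookup_scale)
    have "f - lin_ext e h \<in> lin_ext e ` ?A"
    proof (rule Suc.IH)
      show "f - lin_ext e h \<in> S" using subalgebra_diff[OF S Suc.prems(1) in_S[OF hA]] .
      fix d assume d: "d \<in> D" and nz: "?l (f - lin_ext e h) d \<noteq> 0"
      show "q d < b"
      proof (cases "\<exists>d'\<in>?K. d' \<noteq> d \<and> ?l (e (inv_into M \<tau> d')) d \<noteq> 0")
        case True
        then obtain d' where d': "d' \<in> ?K" "d' \<noteq> d" "?l (e (inv_into M \<tau> d')) d \<noteq> 0" by blast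
        then have "q d < q d'" using low[OF \<tau>'(1) d, of d'] \<tau>'(2)[of d'] by auto
        moreover have "q d' < Suc b" using Suc.prems(2)[of d'] d' by (auto simp: in_keys_iff)
        ultimately show ?thesis by simp
      next
        case False
        then have "?l (lin_ext e h) d = (\<Sum>d'\<in>?K. if d' = d then ?l f d else 0)"
          unfolding lh using lead[OF \<tau>'(1)[OF d]] \<tau>'(2)[OF d] by (intro sum.cong) auto
        then have "?l (lin_ext e h) d = ?l f d" using d by (auto simp: in_keys_iff)
        then show ?thesis using nz by (simp add: lookup_minus)
      qed
    qed
    then obtain k where k: "k \<in> ?A" "f - lin_ext e h = lin_ext e k" by blast
    then have "f = lin_ext e (k + h)" by (simp add: lin_ext_add diff_eq_eq)
    moreover have "k + h \<in> ?A" 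
      using subalgebra_monoid_algebra[OF M, where ?'k = 'k] k(1) hA by (simp add: subalgebra_def)
    ultimately show ?case by blast
  qed
  have "f \<in> lin_ext e ` ?A" if "f \<in> S" for f
  proof (rule surj[OF that])
    fix d assume "?l f d \<noteq> 0"
    then have "q d \<le> Max (q ` Poly_Mapping.keys f)" by (intro Max_ge) (auto simp: in_keys_iff)
    then show "q d < Suc (Max (q ` Poly_Mapping.keys f))" by simp
  qed
  then have "lin_ext e ` ?A = S" using in_S by blast
  moreover have "inj_on (lin_ext e) ?A"
  proof (rule inj_onI)
    fix f h assume fh: "f \<in> ?A" "h \<in> ?A" "lin_ext e f = lin_ext e h"
    have "lin_ext e f = lin_ext e (f - h) + lin_ext e h" by (simp flip: lin_ext_add)
    then have "f - h = 0" using subalgebra_diff[OF subalgebra_monoid_algebra[OF M] fh(1,2)] fh(3)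
      by (intro kernel) auto
    then show "f = h" by simp
  qed
  ultimately have "bij_betw (lin_ext e) ?A S" by (simp add: bij_betw_def)
  moreover have "lin_ext e 1 = 1" using lin_ext_single[of e 0 1] e_zero by simp
  ultimately show "algebra_isomorphic ?A S"
    unfolding algebra_isomorphic_def
    using S subalgebra_monoid_algebra[OF M, where ?'k = 'k] lin_ext_mult[of M e, OF e_add]
    by (intro conjI exI[of _ "lin_ext e"]) (auto simp: lin_ext_add lin_ext_scale algebra_scale_conv)
qed

section \<open>Pushing forward along group homomorphisms\<close>

text \<open>The definition makes sense for every map g. It is used below for the elements of the
  group and for multiplication by \<open>N\<close>, which is injective but in general not
  surjective.\<close>

lemma linear_action_conv: "linear_action g f = lin_ext (\<lambda>a. Poly_Mapping.single (g a) 1) f"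
  by (simp add: linear_action_def lin_ext_def mult_single)

lemma linear_action_add: "linear_action g (f + h :: 'a::comm_monoid_add \<Rightarrow>\<^sub>0 'k::field) = linear_action g f + linear_action g h"
  by (simp add: linear_action_conv lin_ext_add)

lemma linear_action_scale:
  "linear_action g (algebra_scale c f :: 'a::comm_monoid_add \<Rightarrow>\<^sub>0 'k::field) = algebra_scale c (linear_action g f)"
  by (simp add: linear_action_conv lin_ext_scale algebra_scale_conv)

lemma linear_action_single [simp]:
  "linear_action g (Poly_Mapping.single a c :: 'a::comm_monoid_add \<Rightarrow>\<^sub>0 'k::field) = Poly_Mapping.single (g a) c"
  by (simp add: linear_action_conv mult_single)

lemma linear_action_one:
  "g 0 = 0 \<Longrightarrow> linear_action g (1 :: 'a::comm_monoid_add \<Rightarrow>\<^sub>0 'k::field) = 1"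
  using linear_action_single[of g 0 1] by simp

lemma linear_action_mult:
  fixes g :: "'a::ab_group_add \<Rightarrow> 'a"
  assumes "additive g"
  shows "linear_action g (f * h :: 'a \<Rightarrow>\<^sub>0 'k::field) = linear_action g f * linear_action g h"
  unfolding linear_action_conv
  by (rule lin_ext_mult[of UNIV]) (simp_all add: mult_single additive.add[OF assms] monoid_algebra_def)

lemma linear_action_lookup:
  fixes g :: "'a::comm_monoid_add \<Rightarrow> 'a"
  assumes "inj g"
  shows "Poly_Mapping.lookup (linear_action g f :: 'a \<Rightarrow>\<^sub>0 'k::field) (g a) = Poly_Mapping.lookup f a"
proof -
  have "Poly_Mapping.lookup (linear_action g f) (g a) =
      (\<Sum>b\<in>Poly_Mapping.keys f. if b = a then Poly_Mapping.lookup f a else 0)"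
    unfolding linear_action_conv lookup_lin_ext
    using assms by (intro sum.cong) (auto simp: lookup_single when_def inj_def)
  then show ?thesis by (simp add: in_keys_iff)
qed

lemma linear_action_lookup_notin:
  fixes g :: "'a::comm_monoid_add \<Rightarrow> 'a"
  assumes "x \<notin> range g"
  shows "Poly_Mapping.lookup (linear_action g f :: 'a \<Rightarrow>\<^sub>0 'k::field) x = 0"
  unfolding linear_action_conv lookup_lin_ext
  using assms by (intro sum.neutral) (auto simp: lookup_single when_def)

lemma linear_action_inj:
  fixes g :: "'a::comm_monoid_add \<Rightarrow> 'a"
  assumes "inj g" and "linear_action g f = (linear_action g h :: 'a \<Rightarrow>\<^sub>0 'k::field)"
  shows "f = h"
  using assms linear_action_lookup[OF assms(1)] by (metis poly_mapping_eqI)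

lemma invariant_algebra_iff:
  fixes f :: "'a::ab_group_add \<Rightarrow>\<^sub>0 'k::field"
  assumes "subgroup_GL G"
  shows "f \<in> invariant_algebra G \<longleftrightarrow> (\<forall>g\<in>G. \<forall>x. Poly_Mapping.lookup f (g x) = Poly_Mapping.lookup f x)"
proof -
  have "linear_action g f = f \<longleftrightarrow> (\<forall>x. Poly_Mapping.lookup f (g x) = Poly_Mapping.lookup f x)" if g: "g \<in> G" for g
  proof -
    have "bij g" using assms g by (auto simp: subgroup_GL_def GL_def)
    then have inj: "inj g" and surj: "surj g" by (auto simp: bij_def)
    have "linear_action g f = f \<longleftrightarrow>
        (\<forall>x. Poly_Mapping.lookup (linear_action g f) (g x) = Poly_Mapping.lookup f (g x))"
      using surj by (auto simp: poly_mapping_eq_iff fun_eq_iff) (metis surjD)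
    then show ?thesis by (auto simp: linear_action_lookup[OF inj])
  qed
  then show ?thesis by (auto simp: invariant_algebra_def)
qed

lemma subalgebra_invariant_algebra:
  assumes "subgroup_GL (G :: ('a::ab_group_add \<Rightarrow> 'a) set)"
  shows "subalgebra (invariant_algebra G :: ('a \<Rightarrow>\<^sub>0 'k::field) set)"
  using GL_additive[OF assms]
  by (auto simp: subalgebra_def invariant_algebra_def linear_action_add linear_action_mult
      linear_action_scale linear_action_one additive.zero)

section \<open>Dual vectors and retractions\<close>

context int_form
begin

lemma perp_span:
  assumes "\<forall>t\<in>T. B y t = 0" and "fixed_part \<in> int_module.span T"
  shows "B y fixed_part = 0"
proof -
  have "int_module.span T \<subseteq> {fixed_part. B y fixed_part = 0}"
    using assms(1) by (intro int_module.span_minimal) (auto simp: int_module.subspace_def add_right)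
  then show ?thesis using assms(2) by blast
qed

text \<open>Gram-Schmidt without denominators: a nonzero multiple of x is moved by the span of
  \<open>T\<close> into its orthogonal complement. A new t is first replaced by its own adjustment
  u; if u = 0, a nonzero multiple of t lies in the old span and orthogonality to t is
  automatic.\<close>

lemma orthogonal_adjust:
  assumes "finite T"
  shows "\<exists>m y. m \<noteq> 0 \<and> y - int_scale m x \<in> int_module.span T \<and> (\<forall>t\<in>T. B y t = 0)"
  using assms
proof (induction T arbitrary: x rule: finite_induct)
  case empty
  show ?case by (intro exI[of _ 1] exI[of _ x]) (simp add: int_module.span_zero)
next
  case (insert t T)
  obtain m y where y: "m \<noteq> 0" "y - int_scale m x \<in> int_module.span T" "\<forall>t\<in>T. B y t = 0"
    using insert.IH by blast
  obtain k u where u: "k \<noteq> 0" "u - int_scale k t \<in> int_module.span T" "\<forall>t\<in>T. B u t = 0"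
    using insert.IH by blast
  have mono: "v \<in> int_module.span (insert t T)" if "v \<in> int_module.span T" for v
    using that int_module.span_mono[of T "insert t T"] by blast
  have t: "k * B v t = B v u" if "\<forall>t\<in>T. B v t = 0" for v
    using perp_span[OF that u(2)] by (simp add: diff_right)
  show ?case
  proof (cases "u = 0")
    case True
    then have "B y t = 0" using t[OF y(3)] u(1) by simp
    then show ?thesis using y mono by blast
  next
    case False
    \<comment> \<open>The projection of y off u, multiplied by B(u, u) to stay integral.\<close>
    define v where "v = int_scale (B u u) y - int_scale (B y u) u"
    have "v - int_scale (B u u * m) x =
        int_scale (B u u) (y - int_scale m x) - int_scale (B y u) (u - int_scale k t) - int_scale (B y u * k) t"
      by (simp add: v_def int_module.scale_right_diff_distrib)
    also have "\<dots> \<in> int_module.span (insert t T)"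
      by (intro int_module.span_diff int_module.span_scale[OF mono[OF y(2)]]
          int_module.span_scale[OF mono[OF u(2)]] int_module.span_scale[OF int_module.span_base] insertI1)
    finally have 1: "v - int_scale (B u u * m) x \<in> int_module.span (insert t T)" .
    have 2: "\<forall>t\<in>T. B v t = 0" using y(3) u(3) by (simp add: v_def diff_left)
    have "B v u = 0" by (simp add: v_def diff_left)
    then have "B v t = 0" using t[OF 2] u(1) by simp
    then show ?thesis using 1 2 False y(1) by (intro exI[of _ "B u u * m"] exI[of _ v]) auto
  qed
qed

end

text \<open>The values f (r x) form a subgroup of the integers, generated by a nonzero value f (r t)
  of least absolute value. Subtracting the matching multiple of r t from r x kills f, preserves the
  zeros of the earlier functionals, and changes nothing where f already vanishes.\<close>

lemma kernel_retraction:
  fixes F :: "('a::ab_group_add \<Rightarrow> int) set"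
  assumes "finite F" and "\<And>f. f \<in> F \<Longrightarrow> additive f"
  shows "\<exists>r. additive r \<and> (\<forall>x. \<forall>f\<in>F. f (r x) = 0) \<and> (\<forall>x. (\<forall>f\<in>F. f x = 0) \<longrightarrow> r x = x)"
  using assms
proof (induction F rule: finite_induct)
  case empty
  show ?case by (intro exI[of _ "\<lambda>x. x"]) (simp add: additive_def)
next
  case (insert f F)
  then obtain r where r: "additive r" "\<And>x h. h \<in> F \<Longrightarrow> h (r x) = 0"
    "\<And>x. (\<forall>h\<in>F. h x = 0) \<Longrightarrow> r x = x" by auto
  have f: "additive f" using insert.prems by simp
  show ?case
  proof (cases "\<forall>x. f (r x) = 0")
    case True
    then show ?thesis using r by (intro exI[of _ r]) auto
  next
    case False
    then obtain t where t: "f (r t) \<noteq> 0" and min: "\<And>x. f (r x) \<noteq> 0 \<Longrightarrow> nat \<bar>f (r t)\<bar> \<le> nat \<bar>f (r x)\<bar>"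
      using ex_has_least_nat[of "\<lambda>x. f (r x) \<noteq> 0" _ "\<lambda>x. nat \<bar>f (r x)\<bar>"] by metis
    have dvd: "f (r t) dvd f (r x)" for x
    proof (rule ccontr)
      assume nd: "\<not> f (r t) dvd f (r x)"
      let ?y = "x - int_scale (f (r x) div f (r t)) t"
      have "f (r ?y) = f (r x) mod f (r t)"
        by (simp add: additive.diff[OF r(1)] additive.diff[OF f] additive_int_scale[OF r(1)]
            additive_int_scale[OF f] minus_div_mult_eq_mod)
      moreover have "f (r x) mod f (r t) \<noteq> 0" using nd by (simp add: dvd_eq_mod_eq_0)
      moreover have "\<bar>f (r x) mod f (r t)\<bar> < \<bar>f (r t)\<bar>" using t by (rule abs_mod_less)
      ultimately show False using min[of ?y] by simp
    qed
    define r' where "r' = (\<lambda>x. r x - int_scale (f (r x) div f (r t)) (r t))"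
    have "additive r'"
      by (simp add: additive_def r'_def additive.add[OF r(1)] additive.add[OF f] div_add[OF dvd dvd]
          int_module.scale_left_distrib)
    moreover have "h (r' x) = 0" if h: "h \<in> insert f F" for x h
    proof -
      have "additive h" using insert.prems h by blast
      then have "h (r' x) = h (r x) - f (r x) div f (r t) * h (r t)"
        by (simp add: r'_def additive.diff additive_int_scale)
      then show ?thesis using h r(2)[of h x] r(2)[of h t] dvd[of x] by (cases "h = f") auto
    qed
    moreover have "r' x = x" if "\<forall>h\<in>insert f F. h x = 0" for x
    proof -
      have "r x = x" using that r(3) by simp
      then show ?thesis using that by (simp add: r'_def)
    qed
    ultimately show ?thesis by blast
  qed
qed

context integral_reflection_group
begin

section \<open>Integral multiples of the fundamental weights\<close>

lemma span_comb:
  assumes "x \<in> int_module.span simple"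
  obtains n where "x = comb n"
  using assms by (auto simp: int_module.span_finite[OF finite_simple] comb_def)

text \<open>A multiple m a is made orthogonal to the other simple roots. The result y is nonzero by
  independence, and B(y, y) = m B(y, a) shows that it is not orthogonal to a; at worst its sign has
  to be changed.\<close>

lemma dual_vector:
  assumes a: "a \<in> simple"
  shows "\<exists>y\<in>int_module.span simple. B y a > 0 \<and> (\<forall>b\<in>simple - {a}. B y b = 0)"
proof -
  let ?T = "simple - {a}"
  obtain m y where y: "m \<noteq> 0" "y - int_scale m a \<in> int_module.span ?T" "\<forall>b\<in>?T. B y b = 0"
    using orthogonal_adjust[of ?T a] finite_simple by blast
  have "int_module.span ?T \<subseteq> int_module.span simple" by (intro int_module.span_mono) blast
  then have "y - int_scale m a \<in> int_module.span simple" using y(2) by blast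
  from int_module.span_add[OF this int_module.span_scale[OF int_module.span_base[OF a]]]
  have "(y - int_scale m a) + int_scale m a \<in> int_module.span simple" .
  then have span: "y \<in> int_module.span simple" by simp
  have "y \<noteq> 0"
  proof
    assume "y = 0"
    then have "- int_scale m a \<in> int_module.span ?T" using y(2) by simp
    then obtain u where u: "- int_scale m a = (\<Sum>b\<in>?T. int_scale (u b) b)"
      using int_module.span_finite[of ?T] finite_simple by auto
    have "comb (u(a := m)) = int_scale m a + (\<Sum>b\<in>?T. int_scale (u b) b)"
      unfolding comb_def using finite_simple a by (simp add: sum.remove)
    then have "comb (u(a := m)) = 0" by (simp flip: u)
    from simple_independent[OF this a] show False using y(1) by simp
  qed
  have "B y y = m * B y a" using perp_span[OF y(3,2)] by (simp add: diff_right)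
  then have "B y a \<noteq> 0" using \<open>y \<noteq> 0\<close> pos[of y] by auto
  then consider "B y a > 0" | "B (- y) a > 0" by fastforce
  then show ?thesis
  proof cases
    case 1
    then show ?thesis using span y(3) by blast
  next
    case 2
    then show ?thesis using int_module.span_neg[OF span] y(3) by (intro bexI[of _ "- y"]) auto
  qed
qed

text \<open>The dual vectors have different positive coroot values \<open>c a\<close> at their own
  roots. Taking for \<open>N\<close> the product of all of them and multiplying each
  \<open>y a\<close> by the remaining factors makes these values equal.\<close>

lemma scaled_weights:
  obtains N l where "N > 0" and "\<And>a. a \<in> simple \<Longrightarrow> l a \<in> int_module.span simple"
    and "\<And>a b. a \<in> simple \<Longrightarrow> b \<in> simple \<Longrightarrow> coroot b (l a) = (if b = a then N else 0)"
proof -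
  obtain y where y: "\<And>a. a \<in> simple \<Longrightarrow> y a \<in> int_module.span simple"
    "\<And>a. a \<in> simple \<Longrightarrow> B (y a) a > 0"
    "\<And>a b. a \<in> simple \<Longrightarrow> b \<in> simple \<Longrightarrow> b \<noteq> a \<Longrightarrow> B (y a) b = 0"
  proof -
    have "\<forall>a\<in>simple. \<exists>y. y \<in> int_module.span simple \<and> B y a > 0 \<and> (\<forall>b\<in>simple - {a}. B y b = 0)"
      using dual_vector by blast
    from bchoice[OF this] show thesis using that by blast
  qed
  define c where "c a = coroot a (y a)" for a
  have c: "c a > 0" if "a \<in> simple" for a
    using coroot_pos_iff[OF simple_roots[OF that]] y(2)[OF that] by (simp add: c_def)
  define N where "N = prod c simple"
  define l where "l a = int_scale (prod c (simple - {a})) (y a)" for a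
  have N: "N = prod c (simple - {a}) * c a" if "a \<in> simple" for a
    unfolding N_def using finite_simple that by (simp add: prod.remove mult.commute)
  show thesis
  proof
    show "N > 0" unfolding N_def using c by (intro prod_pos) auto
    show "l a \<in> int_module.span simple" if "a \<in> simple" for a
      unfolding l_def using y(1)[OF that] by (rule int_module.span_scale)
    show "coroot b (l a) = (if b = a then N else 0)" if ab: "a \<in> simple" "b \<in> simple" for a b
    proof -
      have eq: "coroot b (l a) = prod c (simple - {a}) * coroot b (y a)"
        using additive_int_scale[OF additive_coroot[OF simple_roots[OF ab(2)]]] by (simp add: l_def)
      show ?thesis
      proof (cases "b = a")
        case True
        then show ?thesis using eq N[OF ab(1)] by (simp add: c_def)
      next
        case False
        then show ?thesis using eq y(3)[OF ab] by (simp add: coroot_def)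
      qed
    qed
  qed
qed

lemma dominant_zero: "0 \<in> dominant"
  using additive.zero[OF additive_coroot[OF simple_roots]] by (simp add: dominant_def)

lemma dominant_add: "x \<in> dominant \<Longrightarrow> y \<in> dominant \<Longrightarrow> x + y \<in> dominant"
  using additive.add[OF additive_coroot[OF simple_roots]] by (simp add: dominant_def)

lemma invariant_determined:
  fixes f :: "'a \<Rightarrow>\<^sub>0 'k::field"
  assumes "f \<in> invariant_algebra G" and "\<And>d. d \<in> dominant \<Longrightarrow> Poly_Mapping.lookup f d = 0"
  shows "f = 0"
proof (rule poly_mapping_eqI)
  fix x
  obtain w where "w \<in> G" "w x \<in> dominant" using dominant_exists by blast
  then show "Poly_Mapping.lookup f x = Poly_Mapping.lookup 0 x"
    using assms by (metis invariant_algebra_iff[OF group] lookup_zero)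
qed

lemma fixed_retraction:
  obtains r where "additive r" and "\<And>x. r x \<in> fixed_points G" and "\<And>x. x \<in> fixed_points G \<Longrightarrow> r x = x"
proof -
  have "\<exists>r. additive r \<and> (\<forall>x. \<forall>f\<in>coroot ` simple. f (r x) = 0) \<and>
      (\<forall>x. (\<forall>f\<in>coroot ` simple. f x = 0) \<longrightarrow> r x = (x::'a))"
    using finite_simple additive_coroot[OF simple_roots] by (intro kernel_retraction) auto
  then show thesis using that by (auto simp: fixed_iff)
qed

end

section \<open>Invariants from scaled orbit sums\<close>

locale scaled_weight_system = integral_reflection_group B G
  for B :: "'a::ab_group_add \<Rightarrow> 'a \<Rightarrow> int" and G :: "('a \<Rightarrow> 'a) set" +
  fixes N :: int and l :: "'a \<Rightarrow> 'a"
  assumes N_pos: "N > 0"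
    and l_span: "a \<in> simple \<Longrightarrow> l a \<in> int_module.span simple"
    and coroot_l: "a \<in> simple \<Longrightarrow> b \<in> simple \<Longrightarrow> coroot b (l a) = (if b = a then N else 0)"
begin

text \<open>This is \<open>N\<close> times the average of x over the group; the formula exhibits it
  as a lattice element.\<close>

definition fixed_part :: "'a \<Rightarrow> 'a" where
  "fixed_part x = int_scale N x - (\<Sum>a\<in>simple. int_scale (coroot a x) (l a))"

lemma scale_decomposition: "int_scale N x = fixed_part x + (\<Sum>a\<in>simple. int_scale (coroot a x) (l a))"
  by (simp add: fixed_part_def)

lemma fixed_part_fixed: "fixed_part x \<in> fixed_points G"
  unfolding fixed_iff
proof
  fix b assume b: "b \<in> simple"
  note add = additive_coroot[OF simple_roots[OF b]]
  have "coroot b (fixed_part x) = N * coroot b x - (\<Sum>a\<in>simple. coroot a x * coroot b (l a))"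
    by (simp add: fixed_part_def additive.diff[OF add] additive.sum[OF add] additive_int_scale[OF add])
  also have "(\<Sum>a\<in>simple. coroot a x * coroot b (l a)) = (\<Sum>a\<in>simple. if a = b then coroot b x * N else 0)"
    using b by (intro sum.cong) (auto simp: coroot_l)
  finally show "coroot b (fixed_part x) = 0" using finite_simple b by simp
qed

lemma additive_fixed_part: "additive fixed_part"
proof
  show "fixed_part (x + y) = fixed_part x + fixed_part y" for x y
    using additive.add[OF additive_coroot[OF simple_roots]]
    by (simp add: fixed_part_def int_module.scale_right_distrib int_module.scale_left_distrib sum.distrib)
qed

lemma l_dominant: "a \<in> simple \<Longrightarrow> l a \<in> dominant"
  using N_pos by (simp add: dominant_def coroot_l)

text \<open>The factor \<open>N\<close> stays in the strict order relation: it records that lower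
  exponents are congruent to the leading one modulo \<open>N\<close>.\<close>

definition proper_cone :: "'a set" where
  "proper_cone = int_scale N ` root_cone - {0}"

text \<open>Nonzero elements cannot cancel, because the root cone is pointed
  (\<open>cone_antisym\<close>).\<close>

lemma proper_cone_add:
  assumes "x \<in> proper_cone" "y \<in> proper_cone"
  shows "x + y \<in> proper_cone"
proof -
  obtain p q where pq: "p \<in> root_cone" "q \<in> root_cone" "x = int_scale N p" "y = int_scale N q"
    using assms by (auto simp: proper_cone_def)
  have "x + y = int_scale N (p + q)" by (simp add: pq int_module.scale_right_distrib)
  moreover have "p + q \<noteq> 0"
  proof
    assume "p + q = 0"
    then have "q = - p" by (simp add: eq_neg_iff_add_eq_0 add.commute)
    then have "p = 0" using cone_antisym pq by simp
    then show False using assms pq by (simp add: proper_cone_def)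
  qed
  ultimately show ?thesis using cone_add[OF pq(1,2)] N_pos by (auto simp: proper_cone_def)
qed

section \<open>Leading exponents with coefficient one\<close>

definition lead :: "'a \<Rightarrow> ('a \<Rightarrow>\<^sub>0 'k::field) \<Rightarrow> bool" where
  "lead x f \<longleftrightarrow> (\<exists>h. f = Poly_Mapping.single x 1 + h \<and> (\<forall>y\<in>Poly_Mapping.keys h. x - y \<in> proper_cone))"

lemma lead_single: "lead x (Poly_Mapping.single x (1::'k::field))"
  unfolding lead_def by (intro exI[of _ 0]) simp

lemma lead_mult:
  assumes "lead x f" and "lead y h"
  shows "lead (x + y) (f * h :: 'a \<Rightarrow>\<^sub>0 'k::field)"
proof -
  obtain f' where f: "f = Poly_Mapping.single x 1 + f'" "\<And>u. u \<in> Poly_Mapping.keys f' \<Longrightarrow> x - u \<in> proper_cone"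
    using assms(1) by (auto simp: lead_def)
  obtain h' where h: "h = Poly_Mapping.single y 1 + h'" "\<And>u. u \<in> Poly_Mapping.keys h' \<Longrightarrow> y - u \<in> proper_cone"
    using assms(2) by (auto simp: lead_def)
  let ?r = "Poly_Mapping.single x 1 * h' + (f' * Poly_Mapping.single y 1 + f' * h')"
  have "f * h = Poly_Mapping.single (x + y) 1 + ?r"
    by (simp add: f h algebra_simps mult_single)
  moreover have "x + y - u \<in> proper_cone" if "u \<in> Poly_Mapping.keys ?r" for u
  proof -
    have "u \<in> Poly_Mapping.keys (Poly_Mapping.single x 1 * h') \<or>
        u \<in> Poly_Mapping.keys (f' * Poly_Mapping.single y 1) \<or> u \<in> Poly_Mapping.keys (f' * h')"
      using that keys_add[of "Poly_Mapping.single x 1 * h'" "f' * Poly_Mapping.single y 1 + f' * h'"]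
        keys_add[of "f' * Poly_Mapping.single y 1" "f' * h'"] by blast
    then consider v where "v \<in> Poly_Mapping.keys h'" "u = x + v"
      | v where "v \<in> Poly_Mapping.keys f'" "u = v + y"
      | v w where "v \<in> Poly_Mapping.keys f'" "w \<in> Poly_Mapping.keys h'" "u = v + w"
      using keys_mult[of "Poly_Mapping.single x 1" h'] keys_mult[of f' "Poly_Mapping.single y 1"]
        keys_mult[of f' h'] by (auto split: if_splits)
    then show ?thesis
    proof cases
      case 1
      then show ?thesis using h(2)[of v] by simp
    next
      case 2
      then show ?thesis using f(2)[of v] by simp
    next
      case 3
      then show ?thesis using proper_cone_add[OF f(2)[of v] h(2)[of w]] by (simp add: algebra_simps)
    qed
  qed
  ultimately show ?thesis unfolding lead_def by blast
qed

lemma lead_one: "lead 0 (1 :: 'a \<Rightarrow>\<^sub>0 'k::field)"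
  using lead_single[of 0] by simp

lemma lead_power: "lead x f \<Longrightarrow> lead (int_scale (int n) x) (f ^ n :: 'a \<Rightarrow>\<^sub>0 'k::field)"
  by (induction n) (simp_all add: lead_one lead_mult int_module.scale_left_distrib)

lemma lead_prod:
  "(\<And>i. i \<in> I \<Longrightarrow> lead (x i) (f i)) \<Longrightarrow> lead (sum x I) (prod f I :: 'a \<Rightarrow>\<^sub>0 'k::field)"
  by (induction I rule: infinite_finite_induct) (simp_all add: lead_one lead_mult)

lemma lead_lookup:
  assumes "lead x (f :: 'a \<Rightarrow>\<^sub>0 'k::field)"
  shows "Poly_Mapping.lookup f x = 1"
    and "Poly_Mapping.lookup f y \<noteq> 0 \<Longrightarrow> x - y \<in> int_scale N ` root_cone"
proof -
  obtain h where h: "f = Poly_Mapping.single x 1 + h" "\<And>u. u \<in> Poly_Mapping.keys h \<Longrightarrow> x - u \<in> proper_cone"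
    using assms by (auto simp: lead_def)
  have "x \<notin> Poly_Mapping.keys h" using h(2)[of x] by (auto simp: proper_cone_def)
  then show "Poly_Mapping.lookup f x = 1" by (simp add: h(1) lookup_add in_keys_iff)
  assume nz: "Poly_Mapping.lookup f y \<noteq> 0"
  show "x - y \<in> int_scale N ` root_cone"
  proof (cases "y = x")
    case True
    then show ?thesis using cone_zero by (auto intro!: image_eqI[of _ _ 0])
  next
    case False
    then have "y \<in> Poly_Mapping.keys h" using nz by (simp add: h(1) lookup_add lookup_single in_keys_iff when_def)
    then show ?thesis using h(2) by (auto simp: proper_cone_def)
  qed
qed

text \<open>The sum runs over the orbit as a set and not over the group, so that its coefficients
  are 1 in every characteristic, even one dividing the order of a stabilizer.\<close>

definition orbit_sum :: "'a \<Rightarrow> 'a \<Rightarrow>\<^sub>0 'k::field" where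
  "orbit_sum x = (\<Sum>y\<in>(\<lambda>g. g x) ` G. Poly_Mapping.single y 1)"

text \<open>The simple coroots take only the values 0 and \<open>N\<close> on \<open>l a\<close>,
  which is the divisibility required by \<open>dominant_minus_orbit\<close>.\<close>

lemma orbit_sum_lead:
  assumes a: "a \<in> simple"
  shows "lead (l a) (orbit_sum (l a) :: 'a \<Rightarrow>\<^sub>0 'k::field)"
proof -
  let ?O = "(\<lambda>g. g (l a)) ` G"
  have "l a \<in> ?O" using GL_id[OF group] by (auto intro!: image_eqI[of _ _ id])
  then have "orbit_sum (l a) = Poly_Mapping.single (l a) (1::'k) + (\<Sum>y\<in>?O - {l a}. Poly_Mapping.single y 1)"
    unfolding orbit_sum_def using finite_G by (simp add: sum.remove)
  moreover have "l a - y \<in> proper_cone"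
    if "y \<in> Poly_Mapping.keys (\<Sum>y\<in>?O - {l a}. Poly_Mapping.single y (1::'k))" for y
  proof -
    have "y \<in> ?O - {l a}"
      using that keys_sum[of "\<lambda>y. Poly_Mapping.single y (1::'k)" "?O - {l a}"] by auto
    then obtain g where g: "g \<in> G" "y = g (l a)" "y \<noteq> l a" by blast
    have "l a - g (l a) \<in> int_scale N ` root_cone"
      using l_dominant[OF a] N_pos g(1) by (intro dominant_minus_orbit) (auto simp: coroot_l a)
    then show ?thesis using g by (simp add: proper_cone_def)
  qed
  ultimately show ?thesis unfolding lead_def by blast
qed

definition scaled_invariant :: "'a \<Rightarrow> 'a \<Rightarrow>\<^sub>0 'k::field" where
  "scaled_invariant x = Poly_Mapping.single (fixed_part x) 1 * (\<Prod>a\<in>simple. orbit_sum (l a) ^ nat (coroot a x))"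

lemma scaled_invariant_lead:
  assumes "x \<in> dominant"
  shows "lead (int_scale N x) (scaled_invariant x :: 'a \<Rightarrow>\<^sub>0 'k::field)"
proof -
  have "lead (int_scale (coroot a x) (l a)) (orbit_sum (l a) ^ nat (coroot a x) :: 'a \<Rightarrow>\<^sub>0 'k)" if "a \<in> simple" for a
    using lead_power[OF orbit_sum_lead[OF that], of "nat (coroot a x)"] assms that by (simp add: dominant_def)
  then show ?thesis
    unfolding scaled_invariant_def scale_decomposition by (intro lead_mult lead_single lead_prod)
qed

lemma scaled_invariant_zero: "scaled_invariant 0 = (1 :: 'a \<Rightarrow>\<^sub>0 'k::field)"
  using additive.zero[OF additive_coroot[OF simple_roots]]
  by (simp add: scaled_invariant_def additive.zero[OF additive_fixed_part])

text \<open>On dominant elements the coroot values are nonnegative, so \<open>nat\<close> is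
  additive on them and exponents add up.\<close>

lemma scaled_invariant_add:
  assumes "x \<in> dominant" "y \<in> dominant"
  shows "scaled_invariant (x + y) = (scaled_invariant x * scaled_invariant y :: 'a \<Rightarrow>\<^sub>0 'k::field)"
proof -
  have "orbit_sum (l a) ^ nat (coroot a (x + y)) =
      (orbit_sum (l a) ^ nat (coroot a x) * orbit_sum (l a) ^ nat (coroot a y) :: 'a \<Rightarrow>\<^sub>0 'k)" if a: "a \<in> simple" for a
    using assms a additive.add[OF additive_coroot[OF simple_roots[OF a]]]
    by (simp add: dominant_def nat_add_distrib power_add)
  then have "(\<Prod>a\<in>simple. orbit_sum (l a) ^ nat (coroot a (x + y))) =
      (\<Prod>a\<in>simple. orbit_sum (l a) ^ nat (coroot a x)) * (\<Prod>a\<in>simple. orbit_sum (l a) ^ nat (coroot a y) :: 'a \<Rightarrow>\<^sub>0 'k)"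
    by (simp add: prod.distrib)
  moreover have "Poly_Mapping.single (fixed_part (x + y)) (1::'k) = Poly_Mapping.single (fixed_part x) 1 * Poly_Mapping.single (fixed_part y) 1"
    by (simp add: additive.add[OF additive_fixed_part] mult_single)
  ultimately show ?thesis unfolding scaled_invariant_def by (simp only: mult_ac)
qed

lemma orbit_sum_invariant: "orbit_sum x \<in> (invariant_algebra G :: ('a \<Rightarrow>\<^sub>0 'k::field) set)"
  unfolding invariant_algebra_iff[OF group]
proof (intro ballI allI)
  fix g y assume g: "g \<in> G"
  have lookup: "Poly_Mapping.lookup (orbit_sum x :: 'a \<Rightarrow>\<^sub>0 'k) u = (if u \<in> (\<lambda>g. g x) ` G then 1 else 0)" for u
    using finite_G by (simp add: orbit_sum_def lookup_sum lookup_single when_def)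
  have "g y \<in> (\<lambda>g. g x) ` G \<longleftrightarrow> y \<in> (\<lambda>g. g x) ` G"
  proof
    assume "g y \<in> (\<lambda>g. g x) ` G"
    then obtain h where "h \<in> G" "g y = h x" by blast
    then have "y = (inv g \<circ> h) x" "inv g \<circ> h \<in> G"
      using GL_inv[OF group g] GL_comp[OF group] by (auto simp flip: \<open>g y = h x\<close>)
    then show "y \<in> (\<lambda>g. g x) ` G" by blast
  next
    assume "y \<in> (\<lambda>g. g x) ` G"
    then obtain h where h: "h \<in> G" "y = h x" by blast
    have "g y = (g \<circ> h) x" by (simp add: h)
    then show "g y \<in> (\<lambda>g. g x) ` G" using GL_comp[OF group g h(1)] by blast
  qed
  then show "Poly_Mapping.lookup (orbit_sum x :: 'a \<Rightarrow>\<^sub>0 'k) (g y) = Poly_Mapping.lookup (orbit_sum x) y"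
    by (simp add: lookup)
qed

lemma scaled_invariant_invariant: "scaled_invariant x \<in> (invariant_algebra G :: ('a \<Rightarrow>\<^sub>0 'k::field) set)"
proof -
  note S = subalgebra_invariant_algebra[OF group, where ?'k = 'k]
  have "Poly_Mapping.single (fixed_part x) 1 \<in> (invariant_algebra G :: ('a \<Rightarrow>\<^sub>0 'k) set)"
    using fixed_part_fixed[of x] by (auto simp: invariant_algebra_def fixed_points_def)
  moreover have "(\<Prod>a\<in>simple. orbit_sum (l a) ^ nat (coroot a x)) \<in> (invariant_algebra G :: ('a \<Rightarrow>\<^sub>0 'k) set)"
    by (intro subalgebra_prod[OF S] subalgebra_power[OF S] orbit_sum_invariant)
  ultimately show ?thesis using S by (simp add: scaled_invariant_def subalgebra_def)
qed

section \<open>Descent along multiplication by N\<close>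

lemma inj_scale: "inj (int_scale N :: 'a \<Rightarrow> 'a)"
  using N_pos by (simp add: inj_def scale_cancel_left)

lemma additive_scale: "additive (int_scale N :: 'a \<Rightarrow> 'a)"
  by (simp add: additive_def int_module.scale_right_distrib)

text \<open>\<open>map_key\<close> divides the exponents by \<open>N\<close> and silently drops
  those outside the image. For dominant x there are none to drop, since every exponent differs from
  N x by a multiple of \<open>N\<close>; this is \<open>basis_invariant_descends\<close>.\<close>

definition basis_invariant :: "'a \<Rightarrow> 'a \<Rightarrow>\<^sub>0 'k::field" where
  "basis_invariant x = Poly_Mapping.map_key (int_scale N) (scaled_invariant x)"

lemma basis_invariant_lookup: "Poly_Mapping.lookup (basis_invariant x :: 'a \<Rightarrow>\<^sub>0 'k::field) y = Poly_Mapping.lookup (scaled_invariant x) (int_scale N y)"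
  by (simp add: basis_invariant_def Poly_Mapping.map_key.rep_eq[OF inj_scale])

lemma basis_invariant_descends:
  assumes "x \<in> dominant"
  shows "linear_action (int_scale N) (basis_invariant x) = (scaled_invariant x :: 'a \<Rightarrow>\<^sub>0 'k::field)"
proof (rule poly_mapping_eqI)
  fix u
  show "Poly_Mapping.lookup (linear_action (int_scale N) (basis_invariant x)) u = Poly_Mapping.lookup (scaled_invariant x :: 'a \<Rightarrow>\<^sub>0 'k) u"
  proof (cases "u \<in> range (int_scale N)")
    case True
    then show ?thesis by (auto simp: linear_action_lookup[OF inj_scale] basis_invariant_lookup)
  next
    case False
    have "Poly_Mapping.lookup (scaled_invariant x :: 'a \<Rightarrow>\<^sub>0 'k) u = 0"
    proof (rule ccontr)
      assume "\<not> ?thesis"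
      then obtain q where "int_scale N x - u = int_scale N q"
        using lead_lookup(2)[OF scaled_invariant_lead[OF assms]] by blast
      then have "u = int_scale N (x - q)" by (simp add: int_module.scale_right_diff_distrib algebra_simps)
      then show False using False by blast
    qed
    then show ?thesis using linear_action_lookup_notin[OF False] by simp
  qed
qed

lemma basis_invariant_zero: "basis_invariant 0 = (1 :: 'a \<Rightarrow>\<^sub>0 'k::field)"
proof (rule linear_action_inj[OF inj_scale])
  show "linear_action (int_scale N) (basis_invariant 0 :: 'a \<Rightarrow>\<^sub>0 'k) = linear_action (int_scale N) 1"
    by (simp add: basis_invariant_descends[OF dominant_zero] scaled_invariant_zero linear_action_one)
qed

text \<open>Multiplicativity is checked after pushing forward along multiplication by
  \<open>N\<close>, an injective ring homomorphism that turns basis invariants back into products of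
  orbit sums.\<close>

lemma basis_invariant_add:
  assumes "x \<in> dominant" "y \<in> dominant"
  shows "basis_invariant (x + y) = (basis_invariant x * basis_invariant y :: 'a \<Rightarrow>\<^sub>0 'k::field)"
proof (rule linear_action_inj[OF inj_scale])
  show "linear_action (int_scale N) (basis_invariant (x + y) :: 'a \<Rightarrow>\<^sub>0 'k) = linear_action (int_scale N) (basis_invariant x * basis_invariant y)"
    by (simp add: linear_action_mult[OF additive_scale] basis_invariant_descends assms dominant_add scaled_invariant_add)
qed

lemma basis_invariant_invariant: "basis_invariant x \<in> (invariant_algebra G :: ('a \<Rightarrow>\<^sub>0 'k::field) set)"
  using scaled_invariant_invariant[of x, where ?'k = 'k]
  by (simp add: invariant_algebra_iff[OF group] basis_invariant_lookup additive_int_scale[OF additive_G, symmetric])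

lemma basis_invariant_lead: "x \<in> dominant \<Longrightarrow> Poly_Mapping.lookup (basis_invariant x :: 'a \<Rightarrow>\<^sub>0 'k::field) x = 1"
  using lead_lookup(1)[OF scaled_invariant_lead] by (simp add: basis_invariant_lookup)

lemma basis_invariant_low:
  assumes "x \<in> dominant" and "Poly_Mapping.lookup (basis_invariant x :: 'a \<Rightarrow>\<^sub>0 'k::field) y \<noteq> 0"
  shows "x - y \<in> root_cone"
proof -
  obtain q where "q \<in> root_cone" "int_scale N x - int_scale N y = int_scale N q"
    using lead_lookup(2)[OF scaled_invariant_lead[OF assms(1)]] assms(2) unfolding basis_invariant_lookup by blast
  then show ?thesis using N_pos by (simp add: scale_cancel_left flip: int_module.scale_right_diff_distrib)
qed

text \<open>The embedding \<psi> is left open so that the monoid of dominant elements can be moved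
  into the type in which the product of A^G with a set of weights lives.\<close>

theorem invariant_algebra_isomorphic:
  fixes \<psi> :: "'a \<Rightarrow> 'm::comm_monoid_add"
  assumes inj: "inj_on \<psi> dominant" and zero: "\<psi> 0 = 0"
    and add: "\<And>x y. x \<in> dominant \<Longrightarrow> y \<in> dominant \<Longrightarrow> \<psi> (x + y) = \<psi> x + \<psi> y"
  shows "algebra_isomorphic (invariant_algebra G :: ('a \<Rightarrow>\<^sub>0 'k::field) set) (monoid_algebra (\<psi> ` dominant))"
    and "submonoid (\<psi> ` dominant)"
proof -
  let ?\<tau> = "inv_into dominant \<psi>"
  have \<tau>: "?\<tau> (\<psi> x) = x" if "x \<in> dominant" for x using inj that by (rule inv_into_f_f)
  show M: "submonoid (\<psi> ` dominant)"
    unfolding submonoid_def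
  proof (intro conjI ballI)
    show "0 \<in> \<psi> ` dominant" using dominant_zero zero by (auto intro!: image_eqI[of _ _ 0])
    fix m n assume "m \<in> \<psi> ` dominant" "n \<in> \<psi> ` dominant"
    then show "m + n \<in> \<psi> ` dominant" using dominant_add by (auto simp flip: add)
  qed
  show "algebra_isomorphic (invariant_algebra G :: ('a \<Rightarrow>\<^sub>0 'k) set) (monoid_algebra (\<psi> ` dominant))"
  proof (rule triangular_isomorphism[where e = "\<lambda>m. basis_invariant (?\<tau> m)" and \<tau> = ?\<tau> and D = dominant
        and q = "\<lambda>x. nat (B x x)"])
    show "bij_betw ?\<tau> (\<psi> ` dominant) dominant"
      using inj by (intro bij_betw_inv_into) (simp add: bij_betw_def)
    show "basis_invariant (?\<tau> 0) = (1 :: 'a \<Rightarrow>\<^sub>0 'k)" using \<tau>[OF dominant_zero] by (simp add: zero basis_invariant_zero)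
    fix m assume "m \<in> \<psi> ` dominant"
    then obtain x where x: "x \<in> dominant" "m = \<psi> x" by blast
    show "Poly_Mapping.lookup (basis_invariant (?\<tau> m) :: 'a \<Rightarrow>\<^sub>0 'k) (?\<tau> m) = 1" using x by (simp add: \<tau> basis_invariant_lead)
    show "basis_invariant (?\<tau> (m + n)) = (basis_invariant (?\<tau> m) * basis_invariant (?\<tau> n) :: 'a \<Rightarrow>\<^sub>0 'k)" if n: "n \<in> \<psi> ` dominant" for n
    proof -
      obtain y where y: "y \<in> dominant" "n = \<psi> y" using n by blast
      have "?\<tau> (m + n) = x + y" using \<tau>[OF dominant_add[OF x(1) y(1)]] by (simp add: x y add)
      then show ?thesis using x y by (simp add: \<tau> basis_invariant_add)
    qed
    show "nat (B d d) < nat (B (?\<tau> m) (?\<tau> m))"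
      if d: "d \<in> dominant" "Poly_Mapping.lookup (basis_invariant (?\<tau> m) :: 'a \<Rightarrow>\<^sub>0 'k) d \<noteq> 0" "d \<noteq> ?\<tau> m" for d
    proof -
      have "x - d \<in> root_cone" using d(2) basis_invariant_low[OF x(1)] x by (simp add: \<tau>)
      then have "B d d < B x x" using d(3) x by (intro dominant_norm_less[OF d(1)]) (auto simp: \<tau>)
      then show ?thesis using x nonneg[of d] by (simp add: \<tau>)
    qed
  qed (use M subalgebra_invariant_algebra[OF group] basis_invariant_invariant invariant_determined in auto)
qed

end

section \<open>The real root system\<close>

lemma real_embed_additive: "additive real_embed"
  by (simp add: additive_def real_embed_def pure_tensor_add_left)

lemmas real_embed_add = additive.add[OF real_embed_additive]
  and real_embed_diff = additive.diff[OF real_embed_additive]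
  and real_embed_minus = additive.minus[OF real_embed_additive]
  and real_embed_zero = additive.zero[OF real_embed_additive]
  and real_embed_sum = additive.sum[OF real_embed_additive]

lemma real_embed_scale: "real_embed (int_scale n a) = tensor_scale (of_int n) (real_embed a)"
  by (simp add: real_embed_def pure_tensor_int_scale)

lemma tensor_map_real_embed: "additive g \<Longrightarrow> tensor_map g (real_embed a) = real_embed (g a)"
  by (simp add: real_embed_def tensor_map_pure)

context integral_reflection_group
begin

lemma inj_real_embed: "inj (real_embed :: 'a \<Rightarrow> 'a real_ext)"
  using pure_tensor_eq_iff[OF free, where ?'b = real] by (simp add: inj_def real_embed_def)

lemma real_embed_eq_iff [simp]: "real_embed a = real_embed b \<longleftrightarrow> a = (b :: 'a)"
  using inj_real_embed by (auto simp: inj_def)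

lemma real_embed_eq_0_iff [simp]: "real_embed a = 0 \<longleftrightarrow> a = (0 :: 'a)"
  using real_embed_eq_iff[of a 0] by (simp add: real_embed_zero)

lemmas map_add = additive.add[OF additive_tensor_map[OF additive_G]]
  and map_diff = additive.diff[OF additive_tensor_map[OF additive_G]]
  and map_sum = additive.sum[OF additive_tensor_map[OF additive_G]]
  and map_scale = tensor_map_scale[OF additive_G]
  and map_embed = tensor_map_real_embed[OF additive_G]

lemma average_add: "average G (v + w) = average G v + average G w"
  by (simp add: average_def map_add sum.distrib tensor.scale_right_distrib)

lemma average_scale: "average G (tensor_scale r v) = tensor_scale r (average G v)"
proof -
  have "(\<Sum>g\<in>G. tensor_map g (tensor_scale r v)) = tensor_scale r (\<Sum>g\<in>G. tensor_map g v)"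
    by (simp add: map_scale tensor.scale_sum_right)
  then show ?thesis by (simp add: average_def mult.commute)
qed

lemma average_map:
  assumes "g \<in> G"
  shows "average G (tensor_map g v) = average G v"
proof -
  have "(\<Sum>h\<in>G. tensor_map h (tensor_map g v)) = (\<Sum>h\<in>G. tensor_map (h \<circ> g) v)"
    by (intro sum.cong) (simp_all add: tensor_map_comp[OF additive_G additive_G] assms comp_def)
  also have "\<dots> = (\<Sum>h\<in>G. tensor_map h v)" by (rule GL_sum_shift[OF group assms])
  finally show ?thesis by (simp add: average_def)
qed

lemma map_average:
  assumes "g \<in> G"
  shows "tensor_map g (average G v) = average G v"
proof -
  have "(\<Sum>h\<in>G. tensor_map g (tensor_map h v)) = (\<Sum>h\<in>G. tensor_map (g \<circ> h) v)"
    by (intro sum.cong) (simp_all add: tensor_map_comp[OF additive_G additive_G] assms comp_def)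
  also have "\<dots> = (\<Sum>h\<in>G. tensor_map h v)"
  proof (rule sum.reindex_bij_witness[where i = "\<lambda>h. inv g \<circ> h" and j = "\<lambda>h. g \<circ> h"])
    show "inv g \<circ> (g \<circ> h) = h" "g \<circ> (inv g \<circ> h) = h" for h
      using GL_inv[OF group assms] by (auto simp: fun_eq_iff)
  qed (use GL_comp[OF group assms] GL_comp[OF group GL_inv(1)[OF group assms]] in auto)
  finally show ?thesis by (simp add: average_def map_scale map_sum assms)
qed

lemma additive_average: "additive (average G)"
  by (simp add: additive_def average_add)

lemma pi_add: "pi_proj G (v + w) = pi_proj G v + pi_proj G w"
  by (simp add: pi_proj_def average_add)

lemma additive_pi: "additive (pi_proj G)"
  by (simp add: additive_def pi_add)

lemma pi_scale: "pi_proj G (tensor_scale r v) = tensor_scale r (pi_proj G v)"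
  by (simp add: pi_proj_def average_scale tensor.scale_right_diff_distrib)

lemma subspace_range_pi: "tensor.subspace (range (pi_proj G))"
  unfolding tensor.subspace_def
proof (intro conjI ballI allI)
  show "0 \<in> range (pi_proj G)" using additive.zero[OF additive_pi] by (metis rangeI)
  show "x + y \<in> range (pi_proj G)" if "x \<in> range (pi_proj G)" "y \<in> range (pi_proj G)" for x y
    using that by (auto simp flip: pi_add)
  show "tensor_scale c x \<in> range (pi_proj G)" if "x \<in> range (pi_proj G)" for c x
    using that by (auto simp flip: pi_scale)
qed

text \<open>Its own reflection sends a root to its negative while the average is unaffected, so the
  average of a root is zero.\<close>

lemma pi_root:
  assumes "a \<in> roots"
  shows "pi_proj G (real_embed a) = real_embed a"
proof -
  have "average G (real_embed a) = average G (- real_embed a)"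
    using average_map[OF refl_in_G[OF assms], of "real_embed a"]
    by (simp add: map_embed refl_in_G assms refl_self real_embed_minus)
  then have "average G (real_embed a) + average G (real_embed a) = 0"
    by (simp only: additive.minus[OF additive_average] eq_neg_iff_add_eq_0)
  then have "tensor_scale 2 (average G (real_embed a)) = 0"
    using tensor.scale_left_distrib[of 1 1 "average G (real_embed a)"] by simp
  then show ?thesis by (simp add: pi_proj_def)
qed

lemma pi_span:
  assumes "x \<in> int_module.span simple"
  shows "pi_proj G (real_embed x) = real_embed x"
proof -
  obtain n where "x = comb n" using span_comb[OF assms] .
  then show ?thesis
    by (simp add: comb_def real_embed_sum real_embed_scale additive.sum[OF additive_pi] pi_scale pi_root simple_roots)
qed

lemma card_G_pos: "card G > 0"
  using finite_G GL_id[OF group] by (auto simp: card_gt_0_iff)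

lemma pi_eq_0_iff: "pi_proj G (real_embed x) = 0 \<longleftrightarrow> x \<in> fixed_points G"
proof
  assume "pi_proj G (real_embed x) = 0"
  then have "real_embed x = average G (real_embed x)" by (simp add: pi_proj_def)
  then have "real_embed (g x) = real_embed x" if "g \<in> G" for g
    using map_average[OF that, of "real_embed x"] map_embed[OF that, of x] by simp
  then show "x \<in> fixed_points G" by (simp add: fixed_points_def)
next
  assume "x \<in> fixed_points G"
  then have "(\<Sum>g\<in>G. tensor_map g (real_embed x)) = (\<Sum>g\<in>G. real_embed x)"
    by (intro sum.cong) (simp_all add: map_embed fixed_points_def)
  then have "average G (real_embed x) = real_embed x"
    using card_G_pos by (simp add: average_def tensor.sum_constant_scale)
  then show "pi_proj G (real_embed x) = 0" by (simp add: pi_proj_def)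
qed

section \<open>The simple roots as a base of the real root system\<close>

definition base :: "'a real_ext set" where
  "base = real_embed ` simple"

lemma reflection_displacement:
  assumes a: "a \<in> simple"
  shows "v - tensor_map (refl a) v \<in> tensor.span base"
proof (induction v rule: tensor_induct)
  case (pure b x)
  have "pure_tensor b x - tensor_map (refl a) (pure_tensor b x) = tensor_scale (of_int (coroot a b) * x) (real_embed a)"
    using pure_tensor_int_scale[of "coroot a b" a x]
    by (simp add: tensor_map_pure[OF additive_G[OF refl_in_G[OF simple_roots[OF a]]]] refl_def pure_tensor_diff_left
        tensor_scale_pure real_embed_def)
  then show ?case using a by (simp add: tensor.span_scale tensor.span_base base_def)
next
  case (diff v w)
  then show ?case
    using tensor.span_diff[OF diff] by (simp add: map_diff refl_in_G simple_roots a algebra_simps)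
qed

text \<open>The displacement telescopes along the word: each letter contributes the displacement by
  one simple reflection, which is a multiple of its root.\<close>

lemma word_displacement: "word k w \<Longrightarrow> v - tensor_map w v \<in> tensor.span base"
proof (induction arbitrary: v rule: word.induct)
  case word_id
  have add: "additive (\<lambda>a::'a. a)" by (simp add: additive_def)
  have "tensor_map (\<lambda>a. a) v = v"
    by (induction v rule: tensor_induct)
      (simp_all add: tensor_map_pure[OF add] additive.diff[OF additive_tensor_map[OF add]])
  then show ?case by (simp add: tensor.span_zero id_def)
next
  case (word_step k w a)
  have sG: "refl a \<in> G" using refl_in_G[OF simple_roots[OF word_step.hyps(2)]] .
  have "tensor_map (w \<circ> refl a) v = tensor_map w (tensor_map (refl a) v)"
    unfolding comp_def
    by (rule tensor_map_comp[OF additive_G[OF word_in_G[OF word_step.hyps(1)]] additive_G[OF sG], symmetric])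
  then show ?case
    using tensor.span_add[OF reflection_displacement[OF word_step.hyps(2), of v] word_step.IH[of "tensor_map (refl a) v"]]
    unfolding \<open>tensor_map (w \<circ> refl a) v = _\<close> by simp
qed

text \<open>For the harder inclusion, \<open>pi_proj G v\<close> is the mean of the displacements v
  - g v, each of which lies in the span of the simple roots.\<close>

lemma span_base: "tensor.span base = range (pi_proj G)"
proof
  have "base \<subseteq> range (pi_proj G)"
    using pi_root[OF simple_roots] unfolding base_def by (metis image_subsetI rangeI)
  then show "tensor.span base \<subseteq> range (pi_proj G)" using subspace_range_pi by (rule tensor.span_minimal)
next
  show "range (pi_proj G) \<subseteq> tensor.span base"
  proof clarify
    fix v
    have "(\<Sum>g\<in>G. v - tensor_map g v) = tensor_scale (real (card G)) v - (\<Sum>g\<in>G. tensor_map g v)"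
      by (simp add: sum_subtractf tensor.sum_constant_scale)
    then have "pi_proj G v = tensor_scale (1 / real (card G)) (\<Sum>g\<in>G. v - tensor_map g v)"
      using card_G_pos by (simp add: pi_proj_def average_def tensor.scale_right_diff_distrib)
    also have "\<dots> \<in> tensor.span base"
      using word_exists word_displacement by (intro tensor.span_scale tensor.span_sum) blast
    finally show "pi_proj G v \<in> tensor.span base" .
  qed
qed

text \<open>Integral independence does not by itself exclude real relations. The functional B(y, -)
  of a dual vector y extends to the real space by \<open>tensor_eval\<close> and isolates one
  coefficient.\<close>

lemma independent_base: "tensor.independent base"
proof
  assume "tensor.dependent base"
  then obtain u v where v: "v \<in> base" "u v \<noteq> 0" and sum: "(\<Sum>v\<in>base. tensor_scale (u v) v) = 0"
    using tensor.dependent_finite[of base] finite_simple by (auto simp: base_def)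
  obtain a where a: "a \<in> simple" "v = real_embed a" using v(1) by (auto simp: base_def)
  obtain y where y: "B y a > 0" "\<forall>b\<in>simple - {a}. B y b = 0" using dual_vector[OF a(1)] by blast
  note eval = tensor_eval_scale[OF additive_right] and add = additive_tensor_eval[OF additive_right]
  have "0 = tensor_eval (B y) (\<Sum>b\<in>simple. tensor_scale (u (real_embed b)) (real_embed b))"
    using sum by (simp add: additive.zero[OF add] base_def sum.reindex inj_on_subset[OF inj_real_embed])
  also have "\<dots> = (\<Sum>b\<in>simple. u (real_embed b) * of_int (B y b))"
    by (simp add: additive.sum[OF add] eval real_embed_def tensor_eval_pure[OF additive_right])
  also have "\<dots> = (\<Sum>b\<in>simple. if b = a then u v * of_int (B y a) else 0)"
    using y(2) a by (intro sum.cong) auto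
  also have "\<dots> = u v * of_int (B y a)" using finite_simple a(1) by simp
  finally show False using y(1) v(2) by simp
qed

lemma root_system_eq: "root_system G = real_embed ` roots"
  by (auto simp: root_system_def roots_def)

lemma nonneg_combinations_base:
  "nonneg_combinations base f = {\<Sum>a\<in>simple. tensor_scale (real (c a)) (f (real_embed a)) | c. True}"
proof (intro equalityI subsetI)
  fix v assume "v \<in> nonneg_combinations base f"
  then obtain c where "v = (\<Sum>\<alpha>\<in>base. tensor_scale (real (c \<alpha>)) (f \<alpha>))"
    by (auto simp: nonneg_combinations_def)
  then have "v = (\<Sum>a\<in>simple. tensor_scale (real ((c \<circ> real_embed) a)) (f (real_embed a)))"
    by (simp add: base_def sum.reindex inj_on_subset[OF inj_real_embed])
  then show "v \<in> {\<Sum>a\<in>simple. tensor_scale (real (c a)) (f (real_embed a)) | c. True}" by blast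
next
  fix v assume "v \<in> {\<Sum>a\<in>simple. tensor_scale (real (c a)) (f (real_embed a)) | c. True}"
  then obtain c where "v = (\<Sum>a\<in>simple. tensor_scale (real (c a)) (f (real_embed a)))" by blast
  then have "v = (\<Sum>\<alpha>\<in>base. tensor_scale (real ((c \<circ> inv real_embed) \<alpha>)) (f \<alpha>))"
    by (simp add: base_def sum.reindex inj_on_subset[OF inj_real_embed] inv_f_f[OF inj_real_embed])
  then show "v \<in> nonneg_combinations base f" unfolding nonneg_combinations_def by blast
qed

lemma cone_nonneg_combination:
  assumes "q \<in> root_cone"
  shows "real_embed q \<in> nonneg_combinations base (\<lambda>\<alpha>. \<alpha>)"
proof -
  obtain n where n: "q = comb n" "\<And>a. n a \<ge> 0" using cone_E[OF assms] by metis
  have "real_embed q = (\<Sum>a\<in>simple. tensor_scale (real (nat (n a))) (real_embed a))"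
    using n(2) by (simp add: n(1) comb_def real_embed_sum real_embed_scale)
  then show ?thesis
    unfolding nonneg_combinations_base by (intro CollectI exI[of _ "\<lambda>a. nat (n a)"]) simp
qed

lemma root_base: "root_base G base"
  unfolding root_base_def
proof (intro conjI independent_base span_base subsetI)
  show "v \<in> root_system G" if "v \<in> base" for v
    using that simple_roots by (auto simp: root_system_eq base_def)
  fix v assume "v \<in> root_system G"
  then obtain a where a: "a \<in> roots" "v = real_embed a" by (auto simp: root_system_eq)
  from roots_cases[OF a(1)] show "v \<in> nonneg_combinations base (\<lambda>\<alpha>. \<alpha>) \<union> uminus ` nonneg_combinations base (\<lambda>\<alpha>. \<alpha>)"
  proof
    assume "a \<in> pos_roots"
    then show ?thesis using cone_nonneg_combination[OF pos_roots_cone] a by blast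
  next
    assume "- a \<in> pos_roots"
    then have "- v \<in> nonneg_combinations base (\<lambda>\<alpha>. \<alpha>)"
      using cone_nonneg_combination[OF pos_roots_cone] a by (simp flip: real_embed_minus)
    then show ?thesis by (metis UnI2 imageI minus_minus)
  qed
qed

end

section \<open>Fundamental weights and the parametrization of dominant elements\<close>

context scaled_weight_system
begin

text \<open>Weights are indexed by the elements of the base, so the simple root in the lattice is
  recovered by \<open>inv real_embed\<close>; the division by \<open>N\<close> undoes the scaling of
  \<open>l\<close>.\<close>

definition weight :: "'a real_ext \<Rightarrow> 'a real_ext" where
  "weight \<alpha> = tensor_scale (1 / of_int N) (real_embed (l (inv real_embed \<alpha>)))"

lemma weight_embed: "weight (real_embed a) = tensor_scale (1 / of_int N) (real_embed (l a))"
  by (simp add: weight_def inv_f_f[OF inj_real_embed])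

lemma weight_reflection:
  assumes "a \<in> simple" and "b \<in> simple"
  shows "weight (real_embed a) - tensor_map (refl b) (weight (real_embed a)) = (if b = a then real_embed b else 0)"
proof -
  have "weight (real_embed a) - tensor_map (refl b) (weight (real_embed a)) =
      tensor_scale (1 / of_int N) (real_embed (l a - refl b (l a)))"
    by (simp add: weight_embed map_scale map_embed refl_in_G simple_roots assms(2) real_embed_diff
        tensor.scale_right_diff_distrib)
  also have "l a - refl b (l a) = int_scale (if b = a then N else 0) b"
    by (simp add: refl_def coroot_l assms)
  finally show ?thesis using N_pos by (simp add: real_embed_scale real_embed_zero)
qed

lemma fundamental_weights: "fundamental_weights G base weight"
  unfolding fundamental_weights_def
proof (intro ballI conjI allI impI)
  fix \<alpha> assume "\<alpha> \<in> base"
  then obtain a where a: "a \<in> simple" "\<alpha> = real_embed a" by (auto simp: base_def)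
  have "weight \<alpha> = pi_proj G (weight \<alpha>)"
    by (simp add: a weight_embed pi_scale pi_span l_span)
  then show "weight \<alpha> \<in> range (pi_proj G)" by (metis rangeI)
  fix g b assume gb: "g \<in> G \<and> reflection g \<and> generates_anti_fixed g b \<and> real_embed b \<in> base"
  then have "b \<in> simple" "g = refl b" using root_reflection(3) by (auto simp: base_def)
  then show "weight \<alpha> - tensor_map g (weight \<alpha>) = (if real_embed b = \<alpha> then real_embed b else 0)"
    using weight_reflection[OF a(1)] by (simp add: a)
qed

text \<open>Applying \<open>pi_proj G\<close> to \<open>scale_decomposition\<close> kills the fixed
  part and leaves each \<open>l b\<close> unchanged; cancelling \<open>N\<close> gives the
  expansion.\<close>

lemma pi_weights: "pi_proj G (real_embed x) = (\<Sum>b\<in>simple. tensor_scale (of_int (coroot b x)) (weight (real_embed b)))"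
proof -
  have "tensor_scale (of_int N) (pi_proj G (real_embed x)) = pi_proj G (real_embed (int_scale N x))"
    by (simp add: real_embed_scale pi_scale)
  also have "\<dots> = pi_proj G (real_embed (fixed_part x)) +
      (\<Sum>b\<in>simple. tensor_scale (of_int (coroot b x)) (pi_proj G (real_embed (l b))))"
    unfolding scale_decomposition
    by (simp add: real_embed_add real_embed_sum real_embed_scale pi_add additive.sum[OF additive_pi] pi_scale)
  also have "\<dots> = (\<Sum>b\<in>simple. tensor_scale (of_int (coroot b x)) (real_embed (l b)))"
    using fixed_part_fixed[of x] by (simp add: pi_eq_0_iff[THEN iffD2] pi_span l_span)
  also have "\<dots> = tensor_scale (of_int N) (\<Sum>b\<in>simple. tensor_scale (of_int (coroot b x)) (weight (real_embed b)))"
    using N_pos by (simp add: tensor.scale_sum_right weight_embed)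
  finally show ?thesis using N_pos by simp
qed

text \<open>Conversely, Id - \<open>refl a\<close> annihilates every fundamental weight but the one
  of a. Applied to the given combination it returns the coefficient at a, which must therefore be
  \<open>coroot a x\<close>.\<close>

lemma dominant_iff: "pi_proj G (real_embed x) \<in> dominant_weights base weight \<longleftrightarrow> x \<in> dominant"
proof
  assume "x \<in> dominant"
  then have "pi_proj G (real_embed x) = (\<Sum>b\<in>simple. tensor_scale (real (nat (coroot b x))) (weight (real_embed b)))"
    unfolding pi_weights by (intro sum.cong) (auto simp: dominant_def)
  then show "pi_proj G (real_embed x) \<in> dominant_weights base weight"
    unfolding dominant_weights_def nonneg_combinations_base by (intro CollectI exI[of _ "\<lambda>b. nat (coroot b x)"]) simp
next
  assume "pi_proj G (real_embed x) \<in> dominant_weights base weight"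
  then obtain c where c: "pi_proj G (real_embed x) = (\<Sum>b\<in>simple. tensor_scale (real (c b)) (weight (real_embed b)))"
    unfolding dominant_weights_def nonneg_combinations_base by blast
  have "coroot a x \<ge> 0" if a: "a \<in> simple" for a
  proof -
    note sG = refl_in_G[OF simple_roots[OF a]]
    \<comment> \<open>The average subtracted by \<open>pi_proj G\<close> is fixed by the reflection
      and cancels.\<close>
    have "pi_proj G (real_embed x) - tensor_map (refl a) (pi_proj G (real_embed x)) = real_embed (x - refl a x)"
      by (simp add: pi_proj_def map_diff sG map_average map_embed real_embed_diff)
    then have "tensor_scale (of_int (coroot a x)) (real_embed a) =
        pi_proj G (real_embed x) - tensor_map (refl a) (pi_proj G (real_embed x))"
      by (simp add: refl_def real_embed_scale)
    also have "\<dots> = (\<Sum>b\<in>simple. tensor_scale (real (c b))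
        (weight (real_embed b) - tensor_map (refl a) (weight (real_embed b))))"
      by (simp add: c map_sum map_scale sG tensor.scale_right_diff_distrib sum_subtractf)
    also have "\<dots> = (\<Sum>b\<in>simple. if b = a then tensor_scale (real (c a)) (real_embed a) else 0)"
      by (intro sum.cong) (auto simp: weight_reflection a)
    also have "\<dots> = tensor_scale (real (c a)) (real_embed a)" using finite_simple a by simp
    finally have "of_int (coroot a x) = real (c a)" using root_nonzero[OF simple_roots[OF a]] by simp
    then show ?thesis by linarith
  qed
  then show "x \<in> dominant" by (simp add: dominant_def)
qed

text \<open>Two elements with the same projection differ by an element of A^G, on which r is the
  identity; equal values of r then force the difference to vanish.\<close>

lemma monoid_parametrization:
  assumes r: "additive r" "\<And>x. r x \<in> fixed_points G" "\<And>x. x \<in> fixed_points G \<Longrightarrow> r x = x"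
  shows "inj (\<lambda>x. (r x, pi_proj G (real_embed x)))"
    and "(\<lambda>x. (r x, pi_proj G (real_embed x))) ` dominant =
      fixed_points G \<times> (pi_proj G ` range real_embed \<inter> dominant_weights base weight)"
proof -
  note pi_diff = additive.diff[OF additive_pi]
  show "inj (\<lambda>x. (r x, pi_proj G (real_embed x)))"
  proof (rule injI, elim Pair_inject)
    fix x y assume eq: "r x = r y" "pi_proj G (real_embed x) = pi_proj G (real_embed y)"
    then have "pi_proj G (real_embed (x - y)) = 0" by (simp add: real_embed_diff pi_diff)
    then have "r (x - y) = x - y" using r(3) by (simp add: pi_eq_0_iff)
    then show "x = y" using eq by (simp add: additive.diff[OF r(1)])
  qed
  have "(u, pi_proj G (real_embed x)) \<in> (\<lambda>x. (r x, pi_proj G (real_embed x))) ` dominant"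
    if u: "u \<in> fixed_points G" and x: "x \<in> dominant" for u x
  proof -
    \<comment> \<open>The correction lies in A^G: it replaces the value r x by u and changes neither
      the projection nor, consequently, dominance.\<close>
    let ?y = "x + (u - r x)"
    have "pi_proj G (real_embed u) = 0" "pi_proj G (real_embed (r x)) = 0"
      using u r(2) by (auto simp: pi_eq_0_iff)
    then have pi: "pi_proj G (real_embed ?y) = pi_proj G (real_embed x)"
      by (simp add: real_embed_add real_embed_diff pi_add pi_diff)
    have "r ?y = u" using r(3)[OF u] r(3)[OF r(2)] by (simp add: additive.add[OF r(1)] additive.diff[OF r(1)])
    moreover have "?y \<in> dominant" using x pi by (simp flip: dominant_iff)
    ultimately show ?thesis using pi by (intro image_eqI[of _ _ ?y]) simp_all
  qed
  then show "(\<lambda>x. (r x, pi_proj G (real_embed x))) ` dominant =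
      fixed_points G \<times> (pi_proj G ` range real_embed \<inter> dominant_weights base weight)"
    using r(2) by (auto simp: dominant_iff)
qed

end

theorem mainTheorem1:
  fixes G :: "('a::ab_group_add \<Rightarrow> 'a) set"
  assumes "free_abelian_finite_rank TYPE('a)"
    and "subgroup_GL G" and "finite G" and "generated_by_reflections G"
  shows "is_semigroup_algebra TYPE('a \<times> 'a real_ext) (invariant_algebra G :: ('a \<Rightarrow>\<^sub>0 'k::field) set) \<and>
    (\<exists>\<Delta> \<omega>. root_base G \<Delta> \<and> fundamental_weights G \<Delta> \<omega> \<and>
       algebra_isomorphic (invariant_algebra G :: ('a \<Rightarrow>\<^sub>0 'k) set)
         (monoid_algebra
           (fixed_points G \<times> (pi_proj G ` range real_embed \<inter> dominant_weights \<Delta> \<omega>))))"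
proof -
  obtain B :: "'a \<Rightarrow> 'a \<Rightarrow> int" where B: "int_form B" "\<And>g x y. g \<in> G \<Longrightarrow> B (g x) (g y) = B x y"
    using invariant_form[OF assms(1-3)] by blast
  interpret integral_reflection_group B G
    using B assms by (simp add: integral_reflection_group_def integral_reflection_group_axioms_def)
  obtain N l where Nl: "N > 0" "\<And>a. a \<in> simple \<Longrightarrow> l a \<in> int_module.span simple"
    "\<And>a b. a \<in> simple \<Longrightarrow> b \<in> simple \<Longrightarrow> coroot b (l a) = (if b = a then N else 0)"
    using scaled_weights by metis
  interpret scaled_weight_system B G N l
    by unfold_locales (use Nl in auto)
  obtain r where r: "additive r" "\<And>x. r x \<in> fixed_points G" "\<And>x. x \<in> fixed_points G \<Longrightarrow> r x = x"
    using fixed_retraction by metis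
  let ?\<psi> = "\<lambda>x. (r x, pi_proj G (real_embed x))"
  have zero: "?\<psi> 0 = 0"
    by (simp add: additive.zero[OF r(1)] real_embed_zero additive.zero[OF additive_pi] zero_prod_def)
  have add: "?\<psi> (x + y) = ?\<psi> x + ?\<psi> y" for x y
    by (simp add: additive.add[OF r(1)] real_embed_add pi_add)
  have inj: "inj_on ?\<psi> dominant"
    using monoid_parametrization(1) r inj_on_subset by blast
  note iso = invariant_algebra_isomorphic[of ?\<psi>, OF inj zero add]
  have image: "?\<psi> ` dominant = fixed_points G \<times> (pi_proj G ` range real_embed \<inter> dominant_weights base weight)"
    using r by (rule monoid_parametrization(2))
  have "is_semigroup_algebra TYPE('a \<times> 'a real_ext) (invariant_algebra G :: ('a \<Rightarrow>\<^sub>0 'k) set)"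
    unfolding is_semigroup_algebra_def using iso by blast
  then show ?thesis
    using iso(1)[unfolded image] root_base fundamental_weights by blast
qed

end
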